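(* There is an $O(N\,\mathrm{poly}(D))$-time reduction from a Restricted OAPT instance with two sets $A,B$ of $N$ tensors of size $D$ to an instance of Regular Expression Membership Testing with a regular expression $R$ of length $O(N\,\mathrm{poly}(D))$ and a string $S$ of length $O(N\,\mathrm{poly}(D))$ (the answer is preserved).
   Context: For even $t$, tensors $u,v\in\{0,1\}^{2\times\cdots\times2}$ ($t$ factors, size $D=2^t$) indexed by $i\in\{0,1\}^t$ have alternating product $p_{\mathrm{alt}}(u,v)=\bigwedge_{i_1}\bigvee_{i_2}\bigwedge_{i_3}\cdots\bigvee_{i_t}(u_i\wedge v_i)$. A tensor $x$ is $\wedge$-invariant if $x_i$ does not depend on $i_1,i_3,\dots,i_{t-1}$. Restricted OAPT: given two sets $A,B$ of $N$ such tensors, where one of the two sets contains only $\wedge$-invariant tensors, decide whether some $(a,b)\in A\times B$ has $p_{\mathrm{alt}}(a,b)=0$. Regular expressions are built from symbols by concatenation, alternation $[R\mid S]$, $[R]^+$, $[R]^*$, with language $L(\cdot)$. Regular Expression Membership Testing: given a regular expression $p$ and a string $s$, decide whether $s\in L(p)$. *)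

theory Defs
  imports Main "HOL-Library.FuncSet"
begin

section \<open>Tensors and Restricted OAPT\<close>

text \<open>
  An index \<open>(i\<^sub>1, \<dots>, i\<^sub>t)\<close> is a list of length \<open>t\<close>, with \<open>i\<^sub>k\<close> at list position \<open>k - 1\<close>.
  Tensors are extensional functions, so that sets of tensors have the right cardinality.
\<close>

definition idx :: "nat \<Rightarrow> bool list set" where
  "idx t = {i. length i = t}"

definition tensors :: "nat \<Rightarrow> (bool list \<Rightarrow> bool) set" where
  "tensors t = idx t \<rightarrow>\<^sub>E UNIV"

fun alt_and :: "nat \<Rightarrow> (bool list \<Rightarrow> bool) \<Rightarrow> bool"
  and alt_or :: "nat \<Rightarrow> (bool list \<Rightarrow> bool) \<Rightarrow> bool" where
  "alt_and 0 f = f []"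
| "alt_and (Suc t) f = (\<forall>b. alt_or t (\<lambda>i. f (b # i)))"
| "alt_or 0 f = f []"
| "alt_or (Suc t) f = (\<exists>b. alt_and t (\<lambda>i. f (b # i)))"

definition p_alt :: "nat \<Rightarrow> (bool list \<Rightarrow> bool) \<Rightarrow> (bool list \<Rightarrow> bool) \<Rightarrow> bool" where
  "p_alt t u v = alt_and t (\<lambda>i. u i \<and> v i)"

text \<open>The list positions of \<open>i\<^sub>2, i\<^sub>4, \<dots>, i\<^sub>t\<close> are the odd ones.\<close>

definition and_invariant :: "nat \<Rightarrow> (bool list \<Rightarrow> bool) \<Rightarrow> bool" where
  "and_invariant t x \<longleftrightarrow>
     (\<forall>i\<in>idx t. \<forall>j\<in>idx t. (\<forall>k<t. odd k \<longrightarrow> i ! k = j ! k) \<longrightarrow> x i = x j)"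

definition restricted_OAPT_instance ::
  "nat \<Rightarrow> nat \<Rightarrow> (bool list \<Rightarrow> bool) set \<Rightarrow> (bool list \<Rightarrow> bool) set \<Rightarrow> bool" where
  "restricted_OAPT_instance t N A B \<longleftrightarrow>
     even t \<and> 1 \<le> N \<and> A \<subseteq> tensors t \<and> B \<subseteq> tensors t \<and> card A = N \<and> card B = N \<and>
     ((\<forall>x\<in>A. and_invariant t x) \<or> (\<forall>x\<in>B. and_invariant t x))"

definition OAPT :: "nat \<Rightarrow> (bool list \<Rightarrow> bool) set \<Rightarrow> (bool list \<Rightarrow> bool) set \<Rightarrow> bool" where
  "OAPT t A B \<longleftrightarrow> (\<exists>a\<in>A. \<exists>b\<in>B. \<not> p_alt t a b)"

section \<open>Regular expressions\<close>

datatype 'a regex =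
    RSym 'a
  | RCat "'a regex" "'a regex"
  | RAlt "'a regex" "'a regex"
  | RPlus "'a regex"
  | RStar "'a regex"

definition conc :: "'a list set \<Rightarrow> 'a list set \<Rightarrow> 'a list set" where
  "conc X Y = {x @ y | x y. x \<in> X \<and> y \<in> Y}"

inductive_set star :: "'a list set \<Rightarrow> 'a list set" for X where
  star_Nil: "[] \<in> star X"
| star_append: "x \<in> X \<Longrightarrow> y \<in> star X \<Longrightarrow> x @ y \<in> star X"

primrec lang :: "'a regex \<Rightarrow> 'a list set" where
  "lang (RSym a) = {[a]}"
| "lang (RCat r s) = conc (lang r) (lang s)"
| "lang (RAlt r s) = lang r \<union> lang s"
| "lang (RPlus r) = conc (lang r) (star (lang r))"
| "lang (RStar r) = star (lang r)"

text \<open>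
  The written form of a regular expression: concatenation is juxtaposition, the other
  operators are \<open>[R|S]\<close>, \<open>[R]+\<close>, \<open>[R]*\<close>.  It determines the expression up to associativity
  of concatenation, hence it determines the language.  Its length is the length of the
  expression.
\<close>

datatype 'a token = TSym 'a | TOpen | TBar | TClose | TPlus | TStar

primrec written :: "'a regex \<Rightarrow> 'a token list" where
  "written (RSym a) = [TSym a]"
| "written (RCat r s) = written r @ written s"
| "written (RAlt r s) = TOpen # written r @ TBar # written s @ [TClose]"
| "written (RPlus r) = TOpen # written r @ [TClose, TPlus]"
| "written (RStar r) = TOpen # written r @ [TClose, TStar]"

definition regex_length :: "'a regex \<Rightarrow> nat" where
  "regex_length r = length (written r)"

section \<open>Word RAM\<close>

text \<open>
  Structured programs of a word RAM with \<open>w\<close>-bit words.  A configuration consists of the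
  registers, of which a program can mention only finitely many, and a random access memory;
  both hold words.  Every instruction and every test takes one time unit.  Subtraction is
  truncated at 0.
\<close>

datatype prog =
    Const nat nat
  | Add nat nat nat
  | Sub nat nat nat
  | Load nat nat
  | Store nat nat
  | Seq prog prog
  | IfLess nat nat prog prog
  | WhileLess nat nat prog

type_synonym config = "(nat \<Rightarrow> nat) \<times> (nat \<Rightarrow> nat)"

inductive exec :: "nat \<Rightarrow> prog \<Rightarrow> config \<Rightarrow> nat \<Rightarrow> config \<Rightarrow> bool" for w where
  Const: "exec w (Const x k) (r, m) 1 (r(x := k mod 2 ^ w), m)"
| Add: "exec w (Add x y z) (r, m) 1 (r(x := (r y + r z) mod 2 ^ w), m)"
| Sub: "exec w (Sub x y z) (r, m) 1 (r(x := r y - r z), m)"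
| Load: "exec w (Load x y) (r, m) 1 (r(x := m (r y)), m)"
| Store: "exec w (Store x y) (r, m) 1 (r, m(r x := r y))"
| Seq: "exec w p s n s' \<Longrightarrow> exec w q s' n' s'' \<Longrightarrow> exec w (Seq p q) s (n + n') s''"
| IfTrue: "r x < r y \<Longrightarrow> exec w p (r, m) n s' \<Longrightarrow> exec w (IfLess x y p q) (r, m) (1 + n) s'"
| IfFalse: "\<not> r x < r y \<Longrightarrow> exec w q (r, m) n s' \<Longrightarrow> exec w (IfLess x y p q) (r, m) (1 + n) s'"
| WhileFalse: "\<not> r x < r y \<Longrightarrow> exec w (WhileLess x y p) (r, m) 1 (r, m)"
| WhileTrue: "r x < r y \<Longrightarrow> exec w p (r, m) n s' \<Longrightarrow> exec w (WhileLess x y p) s' n' s'' \<Longrightarrow>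
    exec w (WhileLess x y p) (r, m) (1 + n + n') s''"

lemma exec_deterministic:
  "exec w p s n s' \<Longrightarrow> exec w p s k s'' \<Longrightarrow> k = n \<and> s'' = s'"
proof (induction arbitrary: k s'' rule: exec.induct)
  case (Seq p s n s' q n' s1)
  from Seq.prems show ?case by cases (use Seq.IH in blast)
next
  case (WhileTrue r x y p m n s' n' s1)
  from WhileTrue.prems show ?case
    by cases (use WhileTrue.hyps WhileTrue.IH in blast)+
next
  case (IfTrue r x y p m n s' q)
  from IfTrue.prems show ?case by cases (use IfTrue.hyps IfTrue.IH in blast)+
next
  case (IfFalse r x y q m n s' p)
  from IfFalse.prems show ?case by cases (use IfFalse.hyps IfFalse.IH in blast)+
qed (erule exec.cases; simp)+

section \<open>Encoding of instances\<close>

fun indices :: "nat \<Rightarrow> bool list list" where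
  "indices 0 = [[]]"
| "indices (Suc t) = map ((#) False) (indices t) @ map ((#) True) (indices t)"

text \<open>One bit per word, the entries of a tensor in lexicographic order of their indices.\<close>

definition tensor_words :: "nat \<Rightarrow> (bool list \<Rightarrow> bool) \<Rightarrow> nat list" where
  "tensor_words t x = map (\<lambda>i. of_bool (x i)) (indices t)"

definition enumerates :: "'a list \<Rightarrow> 'a set \<Rightarrow> bool" where
  "enumerates xs X \<longleftrightarrow> distinct xs \<and> set xs = X"

text \<open>
  Registers 0 and 1 hold \<open>N\<close> and \<open>t\<close>; the tensors of the first set, followed by those of the
  second one, are stored from memory address 0 on.
\<close>

definition OAPT_input ::
  "nat \<Rightarrow> nat \<Rightarrow> (bool list \<Rightarrow> bool) list \<Rightarrow> (bool list \<Rightarrow> bool) list \<Rightarrow> config" where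
  "OAPT_input t N as bs =
     (let ws = concat (map (tensor_words t) (as @ bs))
      in ((\<lambda>_. 0)(0 := N, 1 := t), \<lambda>k. if k < length ws then ws ! k else 0))"

primrec token_word :: "nat token \<Rightarrow> nat" where
  "token_word TOpen = 0"
| "token_word TBar = 1"
| "token_word TClose = 2"
| "token_word TPlus = 3"
| "token_word TStar = 4"
| "token_word (TSym a) = a + 5"

definition stored_at :: "nat \<Rightarrow> (nat \<Rightarrow> nat) \<Rightarrow> nat \<Rightarrow> nat list \<Rightarrow> bool" where
  "stored_at w m p ws \<longleftrightarrow> p + length ws \<le> 2 ^ w \<and> (\<forall>k<length ws. m (p + k) = ws ! k)"

text \<open>
  Registers 0 and 1 hold the start address and the length of the written form of the
  expression, registers 2 and 3 those of the string.
\<close>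

definition membership_output :: "nat \<Rightarrow> config \<Rightarrow> nat regex \<Rightarrow> nat list \<Rightarrow> bool" where
  "membership_output w s R S \<longleftrightarrow>
     (case s of (r, m) \<Rightarrow>
        r 1 = regex_length R \<and> stored_at w m (r 0) (map token_word (written R)) \<and>
        r 3 = length S \<and> stored_at w m (r 2) S)"

end

theory Submission
  imports Defs
begin

text \<open>
  A tensor \<open>v\<close> is written as the word of its \<open>D\<close> bits, and for a tensor \<open>u\<close> there is an expression
  matching exactly the words of those \<open>v\<close> with \<open>p_alt(u, v) = 0\<close>.  Negating the alternating product
  turns each disjunction into a concatenation of the expressions for the two halves of the word,
  and each conjunction into an alternation: one half has to match while the other half, of known
  length, is skipped by a padding \<open>[0|1]\<dots>[0|1]\<close>.  At a leaf, \<open>[0|1]\<close> or \<open>[0|0]\<close> tests \<open>\<not> (u\<^sub>i \<and> v\<^sub>i)\<close>.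
  As all these words have length \<open>D\<close>, surrounding the alternation over \<open>A\<close> by starred paddings of
  length \<open>D\<close> makes it range over the tensors of \<open>B\<close> in their concatenation, which is already
  present in the input.

  The padded expressions of one level all have the same written length, so the program can
  produce them without recursion: each level is an array of blocks obtained from the
  array of the previous level by copying four consecutive blocks into one.
\<close>

section \<open>Words and expressions\<close>

text \<open>A fixed length of the words of \<open>X\<close> determines where a word of the
  concatenation is split, so membership decouples into two independent tests.\<close>

lemma conc_iff_length:
  assumes "\<And>x. x \<in> X \<Longrightarrow> length x = n" and "length x = n"
  shows "x @ y \<in> conc X Y \<longleftrightarrow> x \<in> X \<and> y \<in> Y"
proof
  assume "x @ y \<in> conc X Y"
  then obtain x' y' where "x @ y = x' @ y'" "x' \<in> X" "y' \<in> Y" unfolding conc_def by blast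
  moreover from this have "length x' = length x" using assms by simp
  ultimately show "x \<in> X \<and> y \<in> Y" by simp
next
  assume "x \<in> X \<and> y \<in> Y"
  then show "x @ y \<in> conc X Y" unfolding conc_def by blast
qed

lemma length_conc:
  assumes "\<And>x. x \<in> X \<Longrightarrow> length x = n" and "\<And>y. y \<in> Y \<Longrightarrow> length y = k"
  shows "z \<in> conc X Y \<Longrightarrow> length z = n + k"
  using assms unfolding conc_def by auto

lemma concat_in_star: "set xss \<subseteq> X \<Longrightarrow> concat xss \<in> star X"
  by (induction xss) (auto intro: star.intros)

lemma length_star:
  assumes "\<And>x. x \<in> X \<Longrightarrow> length x = n" and "z \<in> star X"
  shows "\<exists>i. length z = i * n"
  using assms(2)
proof induction
  case star_Nil
  show ?case by (metis list.size(3) mult_0)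
next
  case (star_append x y)
  then obtain i where "length y = i * n" by blast
  with star_append assms(1) have "length (x @ y) = Suc i * n" by simp
  then show ?case by blast
qed

lemma drop_concat_uniform:
  "(\<And>x. x \<in> set xss \<Longrightarrow> length x = n) \<Longrightarrow> drop (i * n) (concat xss) = concat (drop i xss)"
proof (induction xss arbitrary: i)
  case (Cons x xss)
  then show ?case by (cases i) auto
qed simp

text \<open>A prefix in \<open>star X\<close> has a length divisible by \<open>n\<close> and so ends
  at a block boundary of \<open>concat xss\<close>. The word of \<open>Y\<close> that follows has
  length \<open>n\<close> and is therefore exactly one block.\<close>

lemma in_star_conc_star_iff:
  assumes X: "\<And>x. x \<in> X \<Longrightarrow> length x = n" and Y: "\<And>x. x \<in> Y \<Longrightarrow> length x = n"
    and "0 < n" and xss: "set xss \<subseteq> X"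
  shows "concat xss \<in> conc (star X) (conc Y (star X)) \<longleftrightarrow> (\<exists>x\<in>set xss. x \<in> Y)"
proof
  assume "\<exists>x\<in>set xss. x \<in> Y"
  then obtain x ys zs where x: "x \<in> Y" "xss = ys @ x # zs"
    by (meson split_list)
  have "concat ys \<in> star X" "concat zs \<in> star X"
    using xss x by (auto intro!: concat_in_star)
  then show "concat xss \<in> conc (star X) (conc Y (star X))"
    using x unfolding conc_def by auto
next
  assume "concat xss \<in> conc (star X) (conc Y (star X))"
  then obtain a y z where eq: "concat xss = a @ y @ z" and a: "a \<in> star X" and y: "y \<in> Y"
    unfolding conc_def by auto
  obtain i where i: "length a = i * n" using length_star[OF X a] by blast
  have len: "\<And>x. x \<in> set xss \<Longrightarrow> length x = n" using X xss by auto
  have "concat (drop i xss) = y @ z"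
    using drop_concat_uniform[where xss = xss and n = n and i = i, OF len] i eq by simp
  \<comment> \<open>Positivity of \<open>n\<close> makes \<open>y\<close> nonempty, so some block
    remains after the first \<open>i\<close> are dropped.\<close>
  moreover have "y \<noteq> []" using Y[OF y] \<open>0 < n\<close> by auto
  ultimately obtain x zs where d: "drop i xss = x # zs" by (cases "drop i xss") auto
  then have x: "x \<in> set xss" by (metis in_set_dropD list.set_intros(1))
  then have "x = y"
    using \<open>concat (drop i xss) = y @ z\<close> d len[OF x] Y[OF y] by simp
  then show "\<exists>x\<in>set xss. x \<in> Y" using x y by blast
qed

section \<open>The expression for one tensor\<close>

text \<open>The redundant alternation \<open>[0|0]\<close> for a true entry gives both cases the
  same written length of five tokens, on which the fixed block size of the arrays depends.\<close>

definition leaf :: "bool \<Rightarrow> nat regex" where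
  "leaf b = RAlt (RSym 0) (RSym (if b then 0 else 1))"

text \<open>No expression denotes just the empty word, so the recursion starts from one leaf and the
  argument is one less than the matched length.\<close>

fun pad :: "nat \<Rightarrow> nat regex" where
  "pad 0 = leaf False"
| "pad (Suc n) = RCat (leaf False) (pad n)"

text \<open>
  The alternation guesses the value of the universal index for which the product fails.  Since
  \<^term>\<open>pad n\<close> matches the words of length \<open>n + 1\<close>, the entries skipped are \<open>2 * 4 ^ k\<close> many.
\<close>

fun tensor_regex :: "nat \<Rightarrow> (bool list \<Rightarrow> bool) \<Rightarrow> nat regex" where
  "tensor_regex 0 u = leaf (u [])"
| "tensor_regex (Suc k) u =
    RAlt
      (RCat (RCat (tensor_regex k (\<lambda>i. u (False # False # i)))
                  (tensor_regex k (\<lambda>i. u (False # True # i))))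
            (pad (2 * 4 ^ k - 1)))
      (RCat (pad (2 * 4 ^ k - 1))
            (RCat (tensor_regex k (\<lambda>i. u (True # False # i)))
                  (tensor_regex k (\<lambda>i. u (True # True # i)))))"

lemma lang_leaf: "lang (leaf b) = (if b then {[0]} else {[0], [1]})"
  by (auto simp: leaf_def)

lemma lang_pad: "lang (pad n) = {x. length x = Suc n \<and> set x \<subseteq> {0, 1}}"
proof (induction n)
  case 0
  show ?case by (auto simp: lang_leaf length_Suc_conv)
next
  case (Suc n)
  show ?case
  proof (rule set_eqI)
    fix x :: "nat list"
    have "x \<in> lang (pad (Suc n)) \<longleftrightarrow> (\<exists>b y. x = b # y \<and> b \<in> {0, 1} \<and> y \<in> lang (pad n))"
      (is "_ \<longleftrightarrow> ?r")
    proof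
      assume ?r
      then obtain b y where "x = [b] @ y" "[b] \<in> lang (leaf False)" "y \<in> lang (pad n)"
        by (auto simp: lang_leaf)
      then show "x \<in> lang (pad (Suc n))" unfolding pad.simps lang.simps conc_def by blast
    qed (auto simp: lang_leaf conc_def)
    also have "\<dots> \<longleftrightarrow> x \<in> {x. length x = Suc (Suc n) \<and> set x \<subseteq> {0, 1}}"
      unfolding Suc by (cases x) auto
    finally show "x \<in> lang (pad (Suc n)) \<longleftrightarrow> x \<in> {x. length x = Suc (Suc n) \<and> set x \<subseteq> {0, 1}}" .
  qed
qed

text \<open>In either branch two quarters of length \<open>4 ^ k\<close> and a padding of length
  \<open>2 * 4 ^ k\<close> add up to \<open>4 ^ Suc k\<close>. This uniformity makes all later
  splits unique.\<close>

lemma length_lang_tensor_regex: "x \<in> lang (tensor_regex k u) \<Longrightarrow> length x = 4 ^ k"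
proof (induction k arbitrary: u x)
  case 0
  then show ?case by (auto simp: lang_leaf split: if_splits)
next
  case (Suc k)
  have p: "\<And>x. x \<in> lang (pad (2 * 4 ^ k - 1)) \<Longrightarrow> length x = 2 * 4 ^ k"
    by (simp add: lang_pad)
  note L = length_conc[OF Suc.IH Suc.IH]
  from Suc.prems consider
    "x \<in> conc (conc (lang (tensor_regex k (\<lambda>i. u (False # False # i))))
                   (lang (tensor_regex k (\<lambda>i. u (False # True # i))))) (lang (pad (2 * 4 ^ k - 1)))"
  | "x \<in> conc (lang (pad (2 * 4 ^ k - 1)))
             (conc (lang (tensor_regex k (\<lambda>i. u (True # False # i))))
                   (lang (tensor_regex k (\<lambda>i. u (True # True # i)))))"
    unfolding tensor_regex.simps lang.simps by blast
  then show ?case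
  proof cases
    case 1
    from length_conc[OF L p this] show ?thesis by simp
  next
    case 2
    from length_conc[OF p L this] show ?thesis by simp
  qed
qed

lemma length_tensor_words: "length (tensor_words t v) = 2 ^ t"
proof -
  have "length (indices t) = 2 ^ t" by (induction t) auto
  then show ?thesis by (simp add: tensor_words_def)
qed

lemma set_tensor_words: "set (tensor_words t v) \<subseteq> {0, 1}"
  by (auto simp: tensor_words_def)

lemma tensor_words_Suc:
  "tensor_words (Suc t) v =
     tensor_words t (\<lambda>i. v (False # i)) @ tensor_words t (\<lambda>i. v (True # i))"
  by (simp add: tensor_words_def comp_def)

text \<open>The induction peels off two indices at a time. The negated product asks for one value of
  the first index such that the product fails for both values of the second: the alternation makes
  the choice, the concatenation tests both quarters of the chosen half.\<close>

lemma tensor_words_in_lang_iff: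
  "tensor_words (2 * k) v \<in> lang (tensor_regex k u) \<longleftrightarrow> \<not> p_alt (2 * k) u v"
proof (induction k arbitrary: u v)
  case 0
  show ?case by (simp add: lang_leaf p_alt_def tensor_words_def)
next
  case (Suc k)
  let ?T = "\<lambda>a b. tensor_words (2 * k) (\<lambda>i. v (a # b # i))"
  let ?R = "\<lambda>a b. lang (tensor_regex k (\<lambda>i. u (a # b # i)))"
  let ?P = "lang (pad (2 * 4 ^ k - 1))"
  have len: "length (?T a b) = 4 ^ k" for a b
    by (simp add: length_tensor_words power_mult)
  have tw: "tensor_words (2 * Suc k) v =
      (?T False False @ ?T False True) @ (?T True False @ ?T True True)"
    by (simp add: tensor_words_Suc)
  \<comment> \<open>The padding accepts every half word, so the half that is not chosen imposes no
    condition.\<close>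
  have P: "?T a b @ ?T c d \<in> ?P" for a b c d
    using set_tensor_words by (simp add: lang_pad len)
  have lenP: "\<And>x. x \<in> ?P \<Longrightarrow> length x = 2 * 4 ^ k" by (simp add: lang_pad)
  have RR: "?T a b @ ?T c d \<in> conc (?R e f) (?R g h) \<longleftrightarrow> ?T a b \<in> ?R e f \<and> ?T c d \<in> ?R g h"
    for a b c d e f g h
    by (rule conc_iff_length[OF length_lang_tensor_regex len])
  have RRP: "(?T False False @ ?T False True) @ y \<in> conc (conc (?R e f) (?R g h)) ?P \<longleftrightarrow>
      ?T False False @ ?T False True \<in> conc (?R e f) (?R g h) \<and> y \<in> ?P" for e f g h y
    by (rule conc_iff_length[where n = "4 ^ k + 4 ^ k"])
       (auto simp: len dest: length_conc[OF length_lang_tensor_regex length_lang_tensor_regex, rotated 2])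
  have PRR: "(?T False False @ ?T False True) @ y \<in> conc ?P Y \<longleftrightarrow>
      ?T False False @ ?T False True \<in> ?P \<and> y \<in> Y" for Y y
    by (rule conc_iff_length[OF lenP]) (simp_all add: len)
  show ?case
    unfolding tw tensor_regex.simps lang.simps Un_iff RRP PRR RR
    using P by (auto simp: Suc.IH p_alt_def all_bool_eq ex_bool_eq)
qed

section \<open>The expression for a whole instance\<close>

text \<open>Nesting to the left puts all opening brackets in front of the first alternative; the
  written form then needs only one pass over the blocks, each preceded by a bar and followed by a
  closing bracket.\<close>

fun choice :: "nat regex list \<Rightarrow> nat regex \<Rightarrow> nat regex" where
  "choice [] q = q"
| "choice (r # rs) q = choice rs (RAlt q r)"

lemma lang_choice: "lang (choice rs q) = lang q \<union> (\<Union>r\<in>set rs. lang r)"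
  by (induction rs arbitrary: q) auto

text \<open>The symbol \<open>2\<close> occurs in no input word; it stands for the empty alternation.\<close>

definition OAPT_regex :: "nat \<Rightarrow> (bool list \<Rightarrow> bool) list \<Rightarrow> nat regex" where
  "OAPT_regex k us =
     RCat (RStar (pad (4 ^ k - 1)))
       (RCat (choice (map (tensor_regex k) us) (RSym 2)) (RStar (pad (4 ^ k - 1))))"

lemma in_lang_OAPT_regex_iff:
  "concat (map (tensor_words (2 * k)) vs) \<in> lang (OAPT_regex k us) \<longleftrightarrow>
     OAPT (2 * k) (set us) (set vs)"
proof -
  let ?P = "lang (pad (4 ^ k - 1))"
  let ?Y = "\<Union>u\<in>set us. lang (tensor_regex k u)"
  let ?S = "concat (map (tensor_words (2 * k)) vs)"
  have P: "?P = {x. length x = 4 ^ k \<and> set x \<subseteq> {0, 1}}" by (simp add: lang_pad)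
  have lenP: "x \<in> ?P \<Longrightarrow> length x = 4 ^ k" for x unfolding P by simp
  have lenY: "x \<in> ?Y \<Longrightarrow> length x = 4 ^ k" for x using length_lang_tensor_regex by blast
  have sub: "set (map (tensor_words (2 * k)) vs) \<subseteq> ?P"
    unfolding P using set_tensor_words by (auto simp: length_tensor_words power_mult)
  have S01: "set ?S \<subseteq> {0, 1}" using set_tensor_words by auto
  have "?S \<in> lang (OAPT_regex k us) \<longleftrightarrow> ?S \<in> conc (star ?P) (conc ({[2]} \<union> ?Y) (star ?P))"
    by (simp add: OAPT_regex_def lang_choice)
  \<comment> \<open>The word \<open>[2]\<close> need not have length \<open>4 ^ k\<close>, so it has
    to be removed before the alignment argument applies.\<close>
  also have "\<dots> \<longleftrightarrow> ?S \<in> conc (star ?P) (conc ?Y (star ?P))"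
    (is "?l \<longleftrightarrow> ?r")
  proof
    assume ?l
    then obtain a y z where "?S = a @ y @ z" "a \<in> star ?P" "y \<in> {[2]} \<union> ?Y" "z \<in> star ?P"
      unfolding conc_def by blast
    moreover have "y \<noteq> [2]"
    proof
      assume "y = [2]"
      then have "2 \<in> set ?S" using \<open>?S = a @ y @ z\<close> by simp
      then show False using S01 by auto
    qed
    ultimately show ?r unfolding conc_def by blast
  next
    assume ?r then show ?l unfolding conc_def by blast
  qed
  also have "\<dots> \<longleftrightarrow> (\<exists>x\<in>set (map (tensor_words (2 * k)) vs). x \<in> ?Y)"
    by (rule in_star_conc_star_iff[OF lenP lenY _ sub]) simp_all
  also have "\<dots> \<longleftrightarrow> OAPT (2 * k) (set us) (set vs)"
    by (auto simp: OAPT_def tensor_words_in_lang_iff)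
  finally show ?thesis .
qed

section \<open>Timed weakest preconditions\<close>

text \<open>Total correctness with \<open>T\<close> as an upper bound on the time, so that one
  worst-case bound can serve every iteration of a loop.\<close>

definition runs :: "nat \<Rightarrow> prog \<Rightarrow> config \<Rightarrow> nat \<Rightarrow> (config \<Rightarrow> bool) \<Rightarrow> bool" where
  "runs w p s T Q \<longleftrightarrow> (\<exists>n s'. exec w p s n s' \<and> n \<le> T \<and> Q s')"

lemma runs_time: "runs w p s T Q \<Longrightarrow> T \<le> T' \<Longrightarrow> runs w p s T' Q"
  unfolding runs_def by (meson le_trans)

text \<open>Here and in \<open>runs_Add\<close> the side condition excludes overflow, which removes
  the reduction modulo \<open>2 ^ w\<close> from the postcondition.\<close>

lemma runs_Const: "k < 2 ^ w \<Longrightarrow> Q (r(x := k), m) \<Longrightarrow> runs w (Const x k) (r, m) 1 Q"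
  unfolding runs_def using exec.Const[of w x k r m] by auto

lemma runs_Add: "r y + r z < 2 ^ w \<Longrightarrow> Q (r(x := r y + r z), m) \<Longrightarrow> runs w (Add x y z) (r, m) 1 Q"
  unfolding runs_def using exec.Add[of w x y z r m] by auto

lemma runs_Sub: "Q (r(x := r y - r z), m) \<Longrightarrow> runs w (Sub x y z) (r, m) 1 Q"
  unfolding runs_def using exec.Sub[of w x y z r m] by auto

lemma runs_Load: "Q (r(x := m (r y)), m) \<Longrightarrow> runs w (Load x y) (r, m) 1 Q"
  unfolding runs_def using exec.Load[of w x y r m] by auto

lemma runs_Store: "Q (r, m(r x := r y)) \<Longrightarrow> runs w (Store x y) (r, m) 1 Q"
  unfolding runs_def using exec.Store[of w x y r m] by auto

lemma runs_Seq:
  "runs w p s T (\<lambda>s'. runs w q s' T' Q) \<Longrightarrow> runs w (Seq p q) s (T + T') Q"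
  unfolding runs_def by (meson add_mono exec.Seq)

text \<open>The invariant is indexed by the number of completed iterations. Each of the
  \<open>n\<close> iterations pays for its body and one test, and one last test fails.\<close>

lemma runs_While:
  assumes step: "\<And>i r m. i < n \<Longrightarrow> I i r m \<Longrightarrow>
      r x < r y \<and> runs w p (r, m) T (\<lambda>(r', m'). I (Suc i) r' m')"
    and exit: "\<And>r m. I n r m \<Longrightarrow> \<not> r x < r y \<and> Q (r, m)"
    and init: "I 0 r m"
  shows "runs w (WhileLess x y p) (r, m) (n * (T + 1) + 1) Q"
proof -
  \<comment> \<open>The induction is on the number \<open>d\<close> of iterations that
    remain.\<close>
  have "d \<le> n \<Longrightarrow> I (n - d) r m \<Longrightarrow> runs w (WhileLess x y p) (r, m) (d * (T + 1) + 1) Q" for d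
  proof (induction d arbitrary: r m)
    case 0
    then show ?case using exit[of r m] exec.WhileFalse[of r x y w p m] unfolding runs_def by auto
  next
    case (Suc d)
    then have "n - Suc d < n" and eq: "Suc (n - Suc d) = n - d" by auto
    from step[OF this(1) Suc.prems(2)] obtain k r' m' where lt: "r x < r y"
      and k: "exec w p (r, m) k (r', m')" "k \<le> T" and I: "I (n - d) r' m'"
      unfolding runs_def eq by auto
    from Suc.IH[OF _ I] Suc.prems obtain k' s' where
      "exec w (WhileLess x y p) (r', m') k' s'" "k' \<le> d * (T + 1) + 1" "Q s'"
      unfolding runs_def by auto
    with exec.WhileTrue[OF lt k(1)] k(2) show ?case unfolding runs_def
      by (intro exI[of _ "1 + k + k'"] exI[of _ s']) auto
  qed
  from this[of n] init show ?thesis by simp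
qed

fun block :: "prog list \<Rightarrow> prog" where
  "block [p] = p"
| "block (p # q # ps) = Seq p (block (q # ps))"

section \<open>Append-only memory\<close>

text \<open>A list \<open>ms\<close> is laid from address 0 over a background memory
  \<open>m\<close>. Writing at the first address behind the list then amounts to appending an
  element.\<close>

definition store :: "(nat \<Rightarrow> nat) \<Rightarrow> nat list \<Rightarrow> nat \<Rightarrow> nat" where
  "store m ms = (\<lambda>k. if k < length ms then ms ! k else m k)"

definition seg :: "'a list \<Rightarrow> nat \<Rightarrow> nat \<Rightarrow> 'a list" where
  "seg ms a n = take n (drop a ms)"

lemma store_append: "(store m ms)(length ms := x) = store m (ms @ [x])"
  by (auto simp: store_def nth_append fun_eq_iff)

text \<open>This is the frame property: appending leaves every segment already written
  unchanged.\<close>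

lemma seg_append: "a + n \<le> length ms \<Longrightarrow> seg (ms @ xs) a n = seg ms a n"
  by (simp add: seg_def)

lemma length_seg [simp]: "a + n \<le> length ms \<Longrightarrow> length (seg ms a n) = n"
  by (simp add: seg_def)

lemma seg_0 [simp]: "seg ms a 0 = []"
  by (simp add: seg_def)

lemma seg_Suc: "a + n < length ms \<Longrightarrow> seg ms a (Suc n) = seg ms a n @ [ms ! (a + n)]"
  by (simp add: seg_def take_Suc_conv_app_nth)

lemma seg_append_right: "seg (xs @ ys) (length xs + a) n = seg ys a n"
  by (simp add: seg_def)

lemma seg_concat_uniform:
  assumes "\<And>b. b \<in> set bs \<Longrightarrow> length b = n" and "i < length bs"
  shows "seg (concat bs) (i * n) n = bs ! i"
proof -
  have "concat (drop i bs) = bs ! i @ concat (drop (Suc i) bs)"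
    using assms(2) by (metis Cons_nth_drop_Suc concat.simps(2))
  moreover have "length (bs ! i) = n" using assms by simp
  ultimately show ?thesis
    unfolding seg_def using drop_concat_uniform[of bs n i] assms(1) by simp
qed

section \<open>The program\<close>

text \<open>
  Registers: 0 and 1 the input \<open>N\<close> and \<open>t\<close>, 2 \<open>D\<close>, 3 \<open>N * D\<close>, 4 the constant 1, 5 the end of the
  memory written so far, 6 and 7 the position in and the end of the array being read,
  8 the address of the written form of a padding of length \<open>D\<close>, 9 the length of the blocks of
  the array being read, 10 the length of the written form of the current padding, 11 a counter,
  12 to 14 scratch, 15 the start of the output, 16 the constant 0.
\<close>

definition emit :: "nat \<Rightarrow> prog" where
  "emit x = block [Store 5 x, Add 5 5 4]"

definition emit_const :: "nat \<Rightarrow> prog" where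
  "emit_const k = block [Const 12 k, emit 12]"

definition copy :: "nat \<Rightarrow> nat \<Rightarrow> prog" where
  "copy a b = WhileLess a b (block [Load 12 a, emit 12, Add a a 4])"

definition copy_block :: prog where
  "copy_block = block [Add 13 6 9, copy 6 13]"

text \<open>The running pointer is a copy in register 14, made by adding the zero of register 16, so
  the address in register 8 survives. In contrast, \<open>copy_block\<close> advances register 6 to
  the next block.\<close>

definition copy_pad :: prog where
  "copy_pad = block [Add 14 8 16, Add 13 8 10, copy 14 13]"

lemma runs_emit:
  assumes "r 5 = length ms" "r 4 = 1" "Suc (length ms) < 2 ^ w"
    and "Q (r(5 := Suc (length ms)), store m (ms @ [r x]))"
  shows "runs w (emit x) (r, store m ms) 2 Q"
proof -
  have "runs w (emit x) (r, store m ms) (1 + 1) Q"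
    unfolding emit_def block.simps
    by (intro runs_Seq runs_Store runs_Add) (use assms in \<open>simp_all add: store_append\<close>)
  then show ?thesis by (rule runs_time) simp
qed

lemma runs_emit_const:
  assumes "r 5 = length ms" "r 4 = 1" "Suc (length ms) < 2 ^ w" "k < 2 ^ w"
    and "Q (r(12 := k, 5 := Suc (length ms)), store m (ms @ [k]))"
  shows "runs w (emit_const k) (r, store m ms) 3 Q"
proof -
  have "runs w (emit_const k) (r, store m ms) (1 + 2) Q"
    unfolding emit_const_def block.simps
    by (intro runs_Seq runs_Const runs_emit) (use assms in simp_all)
  then show ?thesis by (rule runs_time) simp
qed

text \<open>The source lies entirely in the part written before the loop, so it is stable while
  words are appended. The variable \<open>v\<close> leaves the final content of the scratch register
  open.\<close>

lemma runs_copy: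
  assumes r: "r 5 = length ms" "r 4 = 1" "r b = r a + n"
    and n: "r a + n \<le> length ms" "length ms + n < 2 ^ w"
    and ab: "a \<notin> {4, 5, 12}" "b \<notin> {5, 12, a}"
    and Q: "\<And>v. Q (r(12 := v, 5 := length ms + n, a := r a + n), store m (ms @ seg ms (r a) n))"
  shows "runs w (copy a b) (r, store m ms) (5 * n + 1) Q"
proof -
  define I where "I i r' m' \<longleftrightarrow>
    (\<exists>v. r' = r(12 := v, 5 := length ms + i, a := r a + i) \<and> m' = store m (ms @ seg ms (r a) i))" for i r' m'
  have "runs w (copy a b) (r, store m ms) (n * (4 + 1) + 1) Q"
    unfolding copy_def
  proof (rule runs_While[where I = I])
    fix i r' m' assume i: "i < n" and "I i r' m'"
    then obtain v where r': "r' = r(12 := v, 5 := length ms + i, a := r a + i)"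
      and m': "m' = store m (ms @ seg ms (r a) i)" by (auto simp: I_def)
    have ms: "store m (ms @ seg ms (r a) i) (r a + i) = ms ! (r a + i)"
      using i n by (simp add: store_def nth_append)
    have "runs w (block [Load 12 a, emit 12, Add a a 4]) (r', m') (1 + (2 + 1))
        (\<lambda>(r', m'). I (Suc i) r' m')"
      unfolding block.simps m'
      apply (intro runs_Seq runs_Load runs_emit runs_Add)
      using r n ab i by (auto simp: r' ms I_def seg_Suc fun_eq_iff)
    moreover have "r' a < r' b" using r ab i r' by simp
    ultimately show "r' a < r' b \<and> runs w (block [Load 12 a, emit 12, Add a a 4]) (r', m') 4
        (\<lambda>(r', m'). I (Suc i) r' m')" by (simp add: numeral_eq_Suc)
  next
    fix r' m' assume "I n r' m'"
    then show "\<not> r' a < r' b \<and> Q (r', m')" using Q r ab by (auto simp: I_def)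
  next
    show "I 0 r (store m ms)" unfolding I_def
      using r ab by (intro exI[of _ "r 12"]) (auto simp: fun_eq_iff)
  qed
  then show ?thesis by (rule runs_time) simp
qed

lemma runs_copy_block:
  assumes "r 5 = length ms" "r 4 = 1" "r 9 = l" "r 6 + l \<le> length ms" "length ms + l < 2 ^ w"
    and "\<And>v. Q (r(13 := r 6 + l, 12 := v, 5 := length ms + l, 6 := r 6 + l),
               store m (ms @ seg ms (r 6) l))"
  shows "runs w copy_block (r, store m ms) (5 * l + 2) Q"
proof -
  have "runs w copy_block (r, store m ms) (1 + (5 * l + 1)) Q"
    unfolding copy_block_def block.simps
    by (intro runs_Seq runs_Add runs_copy) (use assms in simp_all)
  then show ?thesis by (rule runs_time) simp
qed

lemma runs_copy_pad:
  assumes "r 5 = length ms" "r 4 = 1" "r 10 = l" "r 16 = 0"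
    and "r 8 + l \<le> length ms" "length ms + l < 2 ^ w"
    and "\<And>v. Q (r(13 := r 8 + l, 12 := v, 5 := length ms + l, 14 := r 8 + l),
               store m (ms @ seg ms (r 8) l))"
  shows "runs w copy_pad (r, store m ms) (5 * l + 3) Q"
proof -
  have "runs w copy_pad (r, store m ms) (1 + (1 + (5 * l + 1))) Q"
    unfolding copy_pad_def block.simps
    by (intro runs_Seq runs_Add runs_copy) (use assms in \<open>simp_all add: fun_upd_twist\<close>)
  then show ?thesis by (rule runs_time) simp
qed

definition copy_two_blocks :: prog where
  "copy_two_blocks = block [copy_block, copy_block]"

lemma runs_copy_two_blocks:
  assumes "r 5 = length ms" "r 4 = 1" "r 9 = l" "r 6 + 2 * l \<le> length ms" "length ms + 2 * l < 2 ^ w"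
    and "\<And>v. Q (r(13 := r 6 + 2 * l, 12 := v, 5 := length ms + 2 * l, 6 := r 6 + 2 * l),
               store m (ms @ seg ms (r 6) (2 * l)))"
  shows "runs w copy_two_blocks (r, store m ms) (10 * l + 4) Q"
proof -
  have "seg ms (r 6) l @ seg ms (r 6 + l) l = seg ms (r 6) (2 * l)"
    by (simp add: seg_def mult_2 take_add add.commute)
  then have "runs w copy_two_blocks (r, store m ms) ((5 * l + 2) + (5 * l + 2)) Q"
    unfolding copy_two_blocks_def block.simps
    by (intro runs_Seq runs_copy_block)
       (use assms in \<open>simp_all add: seg_append fun_upd_twist mult_2 add.assoc\<close>)
  then show ?thesis by (rule runs_time) simp
qed

text \<open>The constants 0, 1 and 2 encode the opening bracket, the bar and the closing bracket of
  the alternation in \<open>tensor_regex\<close>.\<close>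

definition emit_node :: prog where
  "emit_node = block [emit_const 0, copy_two_blocks, copy_pad, emit_const 1,
     copy_pad, copy_two_blocks, emit_const 2]"

lemma runs_emit_node:
  assumes r: "r 5 = length ms" "r 4 = 1" "r 6 = p" "r 9 = l" "r 8 = b" "r 10 = d" "r 16 = 0"
    and "p + 4 * l \<le> length ms" "b + d \<le> length ms" "length ms + 4 * l + 2 * d + 3 < 2 ^ w"
    and Q: "\<And>r'. \<lbrakk>r' 5 = length ms + 4 * l + 2 * d + 3; r' 6 = p + 4 * l;
        \<And>y. y \<notin> {5, 6, 12, 13, 14} \<Longrightarrow> r' y = r y\<rbrakk> \<Longrightarrow>
      Q (r', store m (ms @ [0] @ seg ms p (2 * l) @ seg ms b d @ [1] @
           seg ms b d @ seg ms (p + 2 * l) (2 * l) @ [2]))"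
  shows "runs w emit_node (r, store m ms) (20 * l + 10 * d + 30) Q"
proof -
  have "runs w emit_node (r, store m ms) (3 + ((10 * l + 4) + ((5 * d + 3) + (3 +
      ((5 * d + 3) + ((10 * l + 4) + 3)))))) Q"
    unfolding emit_node_def block.simps
    apply (intro runs_Seq runs_emit_const runs_copy_two_blocks runs_copy_pad)
    using assms(1-10) apply (simp_all add: seg_append)
    using Q by (simp add: seg_append)
  then show ?thesis by (rule runs_time) simp
qed

section \<open>The arrays of written subexpressions\<close>

text \<open>Each group of five words is the code of \<open>[0|1]\<close>; the symbols 0 and 1 are
  encoded as 5 and 6.\<close>

definition pad_tokens :: "nat \<Rightarrow> nat list" where
  "pad_tokens h = concat (replicate h [0, 5, 1, 6, 2])"

definition tokens :: "nat regex \<Rightarrow> nat list" where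
  "tokens R = map token_word (written R)"

text \<open>Four child blocks, two paddings of \<open>2 * 4 ^ k\<close> leaves with five tokens
  each, and three tokens for the brackets and the bar.\<close>

fun node_length :: "nat \<Rightarrow> nat" where
  "node_length 0 = 5"
| "node_length (Suc k) = 4 * node_length k + 20 * 4 ^ k + 3"

text \<open>Fixing the first two indices in lexicographic order makes the four children of a tensor
  consecutive and keeps the entries in memory order.\<close>

definition split4 :: "(bool list \<Rightarrow> bool) list \<Rightarrow> (bool list \<Rightarrow> bool) list" where
  "split4 us = concat (map (\<lambda>u. [\<lambda>i. u (False # False # i), \<lambda>i. u (False # True # i),
                                 \<lambda>i. u (True # False # i), \<lambda>i. u (True # True # i)]) us)"

definition arr :: "nat \<Rightarrow> (bool list \<Rightarrow> bool) list \<Rightarrow> nat list" where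
  "arr k us = concat (map (\<lambda>u. tokens (tensor_regex k u)) us)"

definition entries :: "(bool list \<Rightarrow> bool) list \<Rightarrow> nat list" where
  "entries us = map (\<lambda>u. of_bool (u [])) us"

lemma length_pad_tokens [simp]: "length (pad_tokens h) = 5 * h"
  by (induction h) (auto simp: pad_tokens_def)

text \<open>A single stored padding suffices, since each shorter one is a prefix of it.\<close>

lemma seg_pad_tokens: "h \<le> n \<Longrightarrow> seg (pad_tokens n) 0 (5 * h) = pad_tokens h"
proof -
  assume "h \<le> n"
  then have "pad_tokens n = pad_tokens h @ pad_tokens (n - h)"
    by (metis pad_tokens_def concat_append le_add_diff_inverse replicate_add)
  then show ?thesis by (simp add: seg_def)
qed

lemma tokens_simps [simp]:
  "tokens (RSym a) = [a + 5]"
  "tokens (RCat R S) = tokens R @ tokens S"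
  "tokens (RAlt R S) = 0 # tokens R @ 1 # tokens S @ [2]"
  "tokens (RStar R) = 0 # tokens R @ [2, 4]"
  by (simp_all add: tokens_def)

lemma tokens_leaf: "tokens (leaf b) = [0, 5, 1, 6 - of_bool b, 2]"
  by (simp add: leaf_def)

lemma tokens_pad: "tokens (pad n) = pad_tokens (Suc n)"
  by (induction n) (auto simp: pad_tokens_def tokens_leaf)

lemma tokens_pad_minus_1: "0 < h \<Longrightarrow> tokens (pad (h - Suc 0)) = pad_tokens h"
  by (simp add: tokens_pad)

lemma tokens_choice:
  "tokens (choice rs q) =
     replicate (length rs) 0 @ tokens q @ concat (map (\<lambda>r. 1 # tokens r @ [2]) rs)"
  by (induction rs arbitrary: q) (auto simp: replicate_append_same[symmetric])

text \<open>The expression is brought into the order in which \<open>emit_node\<close> copies: both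
  pairs of quarters are contiguous pieces of the child array.\<close>

lemma tokens_tensor_regex_Suc:
  "tokens (tensor_regex (Suc k) u) =
     [0] @ arr k (take 2 (split4 [u])) @ pad_tokens (2 * 4 ^ k) @ [1] @
     pad_tokens (2 * 4 ^ k) @ arr k (drop 2 (split4 [u])) @ [2]"
  by (simp add: tokens_pad_minus_1 arr_def split4_def)

lemma length_tokens_tensor_regex [simp]: "length (tokens (tensor_regex k u)) = node_length k"
  by (induction k arbitrary: u) (simp_all add: tokens_leaf tokens_pad_minus_1)

lemma length_arr [simp]: "length (arr k us) = length us * node_length k"
  by (induction us) (simp_all add: arr_def)

lemma arr_append [simp]: "arr k (us @ vs) = arr k us @ arr k vs"
  by (simp add: arr_def)

lemma arr_Nil [simp]: "arr k [] = []"
  by (simp add: arr_def)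

lemma split4_append [simp]: "split4 (us @ vs) = split4 us @ split4 vs"
  by (simp add: split4_def)

lemma length_split4 [simp]: "length (split4 us) = 4 * length us"
  by (induction us) (simp_all add: split4_def)

lemma split4_Nil [simp]: "split4 [] = []"
  by (simp add: split4_def)

lemma funpow_split4_append: "(split4 ^^ n) (us @ vs) = (split4 ^^ n) us @ (split4 ^^ n) vs"
  by (induction n) simp_all

lemma length_funpow_split4 [simp]: "length ((split4 ^^ n) us) = 4 ^ n * length us"
  by (induction n) simp_all

text \<open>Splitting down to scalars enumerates the entries lexicographically, so the input memory
  already is the list of scalars from which the leaves are written.\<close>

lemma entries_split4:
  "entries ((split4 ^^ j) us) = concat (map (tensor_words (2 * j)) us)"
proof (induction j arbitrary: us)
  case 0
  show ?case by (induction us) (simp_all add: entries_def tensor_words_def)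
next
  case (Suc j)
  have "concat (map (tensor_words (2 * j)) (split4 us)) =
      concat (map (tensor_words (2 * Suc j)) us)"
    by (induction us) (simp_all add: split4_def tensor_words_Suc)
  then show ?case by (simp add: funpow_swap1 Suc del: funpow.simps(2) add: funpow_Suc_right)
qed

text \<open>All blocks have equal length, so the children of the tensor at position \<open>i\<close>
  start after \<open>4 * i\<close> blocks. The two halves are the pieces copied to the left and to
  the right of the bar.\<close>

lemma arr_split_seg:
  assumes "ms = xs @ arr k (split4 us)" and "i < length us"
  shows "seg ms (length xs + i * (4 * node_length k)) (2 * node_length k) =
           arr k (take 2 (split4 [us ! i]))" (is ?A)
    and "seg ms (length xs + i * (4 * node_length k) + 2 * node_length k) (2 * node_length k) =
           arr k (drop 2 (split4 [us ! i]))" (is ?B)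
proof -
  let ?L = "node_length k"
  have us: "us = take i us @ [us ! i] @ drop (Suc i) us"
    using assms(2) by (simp add: id_take_nth_drop[symmetric])
  have len: "length xs + i * (4 * ?L) = length (xs @ arr k (split4 (take i us)))"
    using assms(2) by simp
  have u: "arr k (split4 [us ! i]) =
      arr k (take 2 (split4 [us ! i])) @ arr k (drop 2 (split4 [us ! i]))"
    by (simp only: append_take_drop_id flip: arr_append)
  have "ms = xs @ arr k (split4 (take i us @ [us ! i] @ drop (Suc i) us))"
    using assms(1) us by simp
  then have ms: "ms = (xs @ arr k (split4 (take i us))) @ arr k (take 2 (split4 [us ! i])) @
      arr k (drop 2 (split4 [us ! i])) @ arr k (split4 (drop (Suc i) us))"
    by (simp only: split4_append arr_append append_assoc u)
  show ?A unfolding len by (subst ms, subst add_0_right[symmetric], subst seg_append_right) (simp add: seg_def)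
  show ?B unfolding len by (subst ms, subst seg_append_right) (simp add: seg_def)
qed

text \<open>The memory contents after \<open>k\<close> levels; nothing is ever overwritten.\<close>

fun history :: "(bool list \<Rightarrow> bool) list \<Rightarrow> nat \<Rightarrow> nat \<Rightarrow> nat list" where
  "history us j 0 = entries ((split4 ^^ j) us) @ arr 0 ((split4 ^^ j) us)"
| "history us j (Suc k) = history us j k @ arr (Suc k) ((split4 ^^ (j - Suc k)) us)"

section \<open>The phases of the program\<close>

text \<open>Subtracting the entry from 6 yields the code of the second symbol, 6 for a false and 5
  for a true entry, without a branch.\<close>

definition emit_leaf :: prog where
  "emit_leaf = block [emit_const 0, emit_const 5, emit_const 1,
     Const 12 6, Load 13 6, Sub 12 12 13, emit 12, emit_const 2, Add 6 6 4]"

lemma runs_emit_leaf: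
  assumes "r 5 = length ms" "r 4 = 1" "r 6 < length ms" "ms ! r 6 = of_bool b"
    and "length ms + 6 < 2 ^ w" "6 < (2::nat) ^ w"
    and Q: "\<And>r'. \<lbrakk>r' 5 = length ms + 5; r' 6 = Suc (r 6);
        \<And>y. y \<notin> {5, 6, 12, 13, 14} \<Longrightarrow> r' y = r y\<rbrakk> \<Longrightarrow>
      Q (r', store m (ms @ [0, 5, 1, 6 - of_bool b, 2]))"
  shows "runs w emit_leaf (r, store m ms) 18 Q"
proof -
  have ld: "store m (ms @ xs) (r 6) = of_bool b" for xs
    using assms(3,4) by (simp add: store_def nth_append)
  have "runs w emit_leaf (r, store m ms)
      (3 + (3 + (3 + (1 + (1 + (1 + (2 + (3 + 1)))))))) Q"
    unfolding emit_leaf_def block.simps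
    apply (intro runs_Seq runs_emit_const runs_emit runs_Const runs_Load runs_Sub runs_Add)
    using assms(1-6) apply (simp_all add: ld)
    using Q by (cases b) simp_all
  then show ?thesis by (rule runs_time) simp
qed

definition emit_leaves :: prog where
  "emit_leaves = WhileLess 6 7 emit_leaf"

lemma runs_emit_leaves:
  fixes us defines "es \<equiv> entries us"
  assumes r: "r 5 = length us" "r 4 = 1" "r 6 = 0" "r 7 = length us"
    and w: "6 * length us + 6 < 2 ^ w"
    and Q: "\<And>r'. \<lbrakk>r' 5 = length (es @ arr 0 us); r' 6 = length us;
        \<And>y. y \<notin> {5, 6, 12, 13, 14} \<Longrightarrow> r' y = r y\<rbrakk> \<Longrightarrow>
      Q (r', store m (es @ arr 0 us))"
  shows "runs w emit_leaves (r, store m es) (length us * 19 + 1) Q"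
proof -
  have len: "length es = length us" by (simp add: es_def entries_def)
  define I where "I i r' m' \<longleftrightarrow> r' 5 = length us + 5 * i \<and> r' 6 = i \<and>
    (\<forall>y. y \<notin> {5, 6, 12, 13, 14} \<longrightarrow> r' y = r y) \<and> m' = store m (es @ arr 0 (take i us))"
    for i and r' m' :: "nat \<Rightarrow> nat"
  have "runs w emit_leaves (r, store m es) (length us * (18 + 1) + 1) Q"
    unfolding emit_leaves_def
  proof (rule runs_While[where I = I])
    fix i r' m' assume i: "i < length us" and I: "I i r' m'"
    have m': "m' = store m (es @ arr 0 (take i us))" using I by (simp add: I_def)
    have nx: "arr 0 (take (Suc i) us) = arr 0 (take i us) @ [0, 5, 1, 6 - of_bool ((us ! i) []), 2]"
      using i by (simp add: take_Suc_conv_app_nth) (simp add: arr_def tokens_leaf)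
    have "runs w emit_leaf (r', m') 18 (\<lambda>(r', m'). I (Suc i) r' m')"
      unfolding m'
    proof (rule runs_emit_leaf[where b = "(us ! i) []"])
      show "(es @ arr 0 (take i us)) ! r' 6 = of_bool ((us ! i) [])"
        using I i by (simp add: I_def nth_append len) (simp add: es_def entries_def)
    qed (use I i w r in \<open>auto simp: I_def len nx\<close>)
    then show "r' 6 < r' 7 \<and> runs w emit_leaf (r', m') 18 (\<lambda>(r', m'). I (Suc i) r' m')"
      using I i r by (simp add: I_def)
  next
    fix r' m' assume "I (length us) r' m'"
    then show "\<not> r' 6 < r' 7 \<and> Q (r', m')" using Q r by (auto simp: I_def len)
  next
    show "I 0 r (store m es)" using r by (simp add: I_def)
  qed
  then show ?thesis by (rule runs_time) simp
qed

text \<open>Register 7 freezes the end of the memory before the level starts, so the loop stops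
  where the old array ends. Register 6 then points to the start of the array just written, ready for
  the next level.\<close>

definition emit_level :: prog where
  "emit_level = block [Add 7 5 16, WhileLess 6 7 emit_node]"

lemma runs_emit_level:
  assumes ms: "ms = xs @ arr k (split4 us)"
    and r: "r 5 = length ms" "r 4 = 1" "r 6 = length xs" "r 9 = node_length k" "r 8 = b"
      "r 10 = 10 * 4 ^ k" "r 16 = 0"
    and b: "b + 10 * 4 ^ k \<le> length ms" "seg ms b (10 * 4 ^ k) = pad_tokens (2 * 4 ^ k)"
    and w: "length (ms @ arr (Suc k) us) < 2 ^ w"
    and Q: "\<And>r'. \<lbrakk>r' 5 = length (ms @ arr (Suc k) us); r' 6 = length ms;
        \<And>y. y \<notin> {5, 6, 7, 12, 13, 14} \<Longrightarrow> r' y = r y\<rbrakk> \<Longrightarrow>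
      Q (r', store m (ms @ arr (Suc k) us))"
  shows "runs w emit_level (r, store m ms) (length us * (5 * node_length (Suc k) + 16) + 2) Q"
proof -
  let ?L = "node_length k"
  define I where "I i r' m' \<longleftrightarrow> r' 5 = length ms + i * node_length (Suc k) \<and>
    r' 6 = length xs + i * (4 * ?L) \<and> r' 7 = length ms \<and>
    (\<forall>y. y \<notin> {5, 6, 7, 12, 13, 14} \<longrightarrow> r' y = r y) \<and> m' = store m (ms @ arr (Suc k) (take i us))"
    for i and r' m' :: "nat \<Rightarrow> nat"
  have lms: "length ms = length xs + length us * (4 * ?L)" by (simp add: ms)
  have loop: "runs w (WhileLess 6 7 emit_node) (r(7 := length ms), store m ms)
      (length us * ((20 * ?L + 10 * (10 * 4 ^ k) + 30) + 1) + 1) Q"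
  proof (rule runs_While[where I = I])
    fix i r' m' assume i: "i < length us" and I: "I i r' m'"
    have m': "m' = store m (ms @ arr (Suc k) (take i us))" using I by (simp add: I_def)
    have "Suc i * (4 * ?L) \<le> length us * (4 * ?L)" using i by (intro mult_right_mono) auto
    then have le: "length xs + i * (4 * ?L) + 4 * ?L \<le> length ms" by (simp add: lms)
    have "Suc i * node_length (Suc k) \<le> length us * node_length (Suc k)"
      using i by (intro mult_right_mono) auto
    then have le2: "length ms + i * node_length (Suc k) + node_length (Suc k) < 2 ^ w"
      using w by (simp add: min_absorb2)
    have nx: "arr (Suc k) (take (Suc i) us) = arr (Suc k) (take i us) @ tokens (tensor_regex (Suc k) (us ! i))"
      using i by (simp add: take_Suc_conv_app_nth del: tensor_regex.simps) (simp add: arr_def)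
    have "runs w emit_node (r', m') (20 * ?L + 10 * (10 * 4 ^ k) + 30) (\<lambda>(r', m'). I (Suc i) r' m')"
      unfolding m'
    proof (rule runs_emit_node[where p = "length xs + i * (4 * ?L)" and b = b], goal_cases)
      case (11 r'')
      have "seg (ms @ ys) b (10 * 4 ^ k) = pad_tokens (2 * 4 ^ k)" for ys
        using b by (simp add: seg_append)
      moreover have "seg (ms @ ys) (length xs + i * (4 * ?L)) (2 * ?L) = arr k (take 2 (split4 [us ! i]))"
        for ys using le arr_split_seg(1)[OF ms i] by (simp add: seg_append)
      moreover have "seg (ms @ ys) (length xs + i * (4 * ?L) + 2 * ?L) (2 * ?L) = arr k (drop 2 (split4 [us ! i]))"
        for ys using le arr_split_seg(2)[OF ms i] by (simp add: seg_append)
      ultimately show ?case using 11 I i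
        unfolding I_def nx tokens_tensor_regex_Suc by (simp add: min_absorb2)
    qed (use I i le le2 r b in \<open>auto simp: I_def min_absorb2\<close>)
    \<comment> \<open>The case distinction on \<open>k\<close> exposes that blocks have positive
      length, which makes the inequality strict.\<close>
    moreover have "r' 6 < r' 7" using le I by (cases k) (auto simp: I_def)
    ultimately show "r' 6 < r' 7 \<and> runs w emit_node (r', m') (20 * ?L + 10 * (10 * 4 ^ k) + 30)
      (\<lambda>(r', m'). I (Suc i) r' m')" by simp
  next
    fix r' m' assume "I (length us) r' m'"
    then show "\<not> r' 6 < r' 7 \<and> Q (r', m')" using Q lms by (auto simp: I_def)
  next
    show "I 0 (r(7 := length ms)) (store m ms)" using r by (simp add: I_def)
  qed
  have "runs w emit_level (r, store m ms)
      (1 + (length us * ((20 * ?L + 10 * (10 * 4 ^ k) + 30) + 1) + 1)) Q"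
    unfolding emit_level_def block.simps
    by (intro runs_Seq runs_Add) (use r w loop in simp_all)
  then show ?thesis by (rule runs_time) simp
qed

lemma take_seg: "n \<le> k \<Longrightarrow> take n (seg ms a k) = seg ms a n"
  by (simp add: seg_def min_absorb1)

text \<open>Register 9 follows the recursion of \<^const>\<open>node_length\<close>, register 10 holds \<open>10 * 4 ^ k\<close>.\<close>

definition next_level :: prog where
  "next_level = block [Add 9 9 9, Add 9 9 9, Add 9 9 10, Add 9 9 10, Const 12 3, Add 9 9 12,
     Add 10 10 10, Add 10 10 10, Add 11 11 4, Add 11 11 4]"

lemma runs_next_level:
  assumes "r 4 = 1" "4 * r 9 + 2 * r 10 + 3 < 2 ^ w" "4 * r 10 < 2 ^ w" "r 11 + 2 < 2 ^ w"
    and Q: "\<And>r'. \<lbrakk>r' 9 = 4 * r 9 + 2 * r 10 + 3; r' 10 = 4 * r 10; r' 11 = r 11 + 2;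
        \<And>y. y \<notin> {9, 10, 11, 12} \<Longrightarrow> r' y = r y\<rbrakk> \<Longrightarrow> Q (r', m)"
  shows "runs w next_level (r, m) 10 Q"
proof -
  have "runs w next_level (r, m) (1 + (1 + (1 + (1 + (1 + (1 + (1 + (1 + (1 + 1))))))))) Q"
    unfolding next_level_def block.simps
    by (intro runs_Seq runs_Add runs_Const Q) (use assms(1-4) in simp_all)
  then show ?thesis by (rule runs_time) simp
qed

text \<open>Register 1 holds \<open>t = 2 * j\<close>; as \<open>next_level\<close> advances the
  counter by two, there are \<open>j\<close> rounds and nothing has to be halved.\<close>

definition emit_levels :: prog where
  "emit_levels = WhileLess 11 1 (block [emit_level, next_level])"

lemma history_prefix: "\<exists>ys. history us j k = history us j 0 @ ys"
  by (induction k) auto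

lemma length_history_mono: "k \<le> l \<Longrightarrow> length (history us j k) \<le> length (history us j l)"
  by (induction l rule: dec_induct) auto

lemma node_length_mono: "k \<le> l \<Longrightarrow> node_length k \<le> node_length l"
  by (induction l rule: dec_induct) auto

text \<open>Since \<open>16 ^ k\<close> is the square of \<open>4 ^ k\<close>, the expression of one
  tensor is at most quadratic in the tensor size.\<close>

lemma node_length_le: "node_length k \<le> 5 * 16 ^ k"
proof (induction k)
  case (Suc k)
  have "(4::nat) ^ k \<le> 16 ^ k" "(1::nat) \<le> 16 ^ k" by (auto intro: power_mono)
  with Suc show ?case unfolding node_length.simps power_Suc by linarith
qed simp

text \<open>The first summand counts the entries. Each of the \<open>Suc k\<close> arrays is bounded
  crudely by the largest number of blocks times the largest block length.\<close>

lemma length_history_le: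
  "k \<le> j \<Longrightarrow> length (history us j k) \<le>
     4 ^ j * length us + Suc k * (4 ^ j * length us * node_length j)"
proof (induction k)
  case 0
  have "5 \<le> node_length j" using node_length_mono[of 0 j] by simp
  then have "4 ^ j * length us * 5 \<le> 4 ^ j * length us * node_length j" by (rule mult_le_mono2)
  then show ?case by (simp add: entries_def)
next
  case (Suc k)
  have "4 ^ (j - Suc k) * length us * node_length (Suc k) \<le> 4 ^ j * length us * node_length j"
    by (intro mult_le_mono node_length_mono) (use Suc in \<open>auto intro: power_increasing\<close>)
  moreover have "length (history us j (Suc k)) =
      length (history us j k) + 4 ^ (j - Suc k) * length us * node_length (Suc k)" by simp
  moreover note Suc
  ultimately show ?case unfolding mult_Suc[of "Suc k"] by linarith
qed

lemma runs_emit_levels: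
  assumes r: "r 5 = length (history us j 0)" "r 4 = 1" "r 6 = 4 ^ j * length us" "r 9 = 5"
      "r 10 = 10" "r 11 = 0" "r 1 = 2 * j" "r 8 = b" "r 16 = 0"
    and b: "b + 5 * 4 ^ j \<le> length (history us j 0)"
      "seg (history us j 0) b (5 * 4 ^ j) = pad_tokens (4 ^ j)"
    and w: "length (history us j j) < 2 ^ w" "node_length j < 2 ^ w" "10 * 4 ^ j < (2::nat) ^ w"
    and Q: "\<And>r' xs. \<lbrakk>history us j j = xs @ arr j us; r' 5 = length (history us j j);
        r' 6 = length xs; r' 9 = node_length j;
        \<And>y. y \<notin> {5, 6, 7, 9, 10, 11, 12, 13, 14} \<Longrightarrow> r' y = r y\<rbrakk> \<Longrightarrow>
      Q (r', store m (history us j j))"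
  shows "runs w emit_levels (r, store m (history us j 0))
    (j * (4 ^ j * length us * (5 * node_length j + 16) + 13) + 1) Q"
proof -
  let ?H = "history us j" and ?U = "\<lambda>k. (split4 ^^ (j - k)) us"
  let ?T = "4 ^ j * length us * (5 * node_length j + 16) + 2"
  define I where "I k r' m' \<longleftrightarrow> (\<exists>xs. ?H k = xs @ arr k (?U k) \<and> r' 6 = length xs) \<and>
    r' 5 = length (?H k) \<and> r' 9 = node_length k \<and> r' 10 = 10 * 4 ^ k \<and> r' 11 = 2 * k \<and>
    (\<forall>y. y \<notin> {5, 6, 7, 9, 10, 11, 12, 13, 14} \<longrightarrow> r' y = r y) \<and> m' = store m (?H k)"
    for k and r' m' :: "nat \<Rightarrow> nat"
  have "runs w emit_levels (r, store m (?H 0))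
      (j * ((?T + 10) + 1) + 1) Q"
    unfolding emit_levels_def
  proof (rule runs_While[where I = I], goal_cases)
    case (1 k r' m')
    then have k: "k < j" and I: "I k r' m'" by auto
    obtain xs where xs: "?H k = xs @ arr k (?U k)" "r' 6 = length xs" using I by (auto simp: I_def)
    have m': "m' = store m (?H k)" using I by (simp add: I_def)
    \<comment> \<open>The tensors of level \<open>k\<close> are the children of those of level
      \<open>Suc k\<close>, which turns the current array into the form read by
      \<open>emit_level\<close>.\<close>
    have "j - k = Suc (j - Suc k)" using k by simp
    then have split: "?H k = xs @ arr k (split4 (?U (Suc k)))" using xs by simp
    have next_H: "?H k @ arr (Suc k) (?U (Suc k)) = ?H (Suc k)" by simp
    obtain ys where ys: "?H k = ?H 0 @ ys" using history_prefix by blast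
    \<comment> \<open>As \<open>k < j\<close>, the padding of \<open>2 * 4 ^ k\<close> leaves needed
      now is a prefix of the stored one with \<open>4 ^ j\<close> leaves.\<close>
    have "(4::nat) ^ Suc k \<le> 4 ^ j" using k by (intro power_increasing) auto
    then have pk: "2 * 4 ^ k \<le> (4::nat) ^ j" "10 * 4 ^ Suc k < (2::nat) ^ w" using w by auto
    have bk: "b + 10 * 4 ^ k \<le> length (?H 0)" using b pk by simp
    have "seg (?H 0) b (10 * 4 ^ k) = take (10 * 4 ^ k) (seg (?H 0) b (5 * 4 ^ j))"
      using pk by (subst take_seg) simp_all
    also have "\<dots> = pad_tokens (2 * 4 ^ k)"
      using seg_pad_tokens[OF pk(1)] b(2) by (simp add: seg_def)
    finally have bseg: "seg (?H k) b (10 * 4 ^ k) = pad_tokens (2 * 4 ^ k)"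
      by (simp only: ys seg_append[OF bk])
    have bk': "b + 10 * 4 ^ k \<le> length (?H k)" using bk by (simp only: ys length_append)
    have wH: "length (?H (Suc k)) < 2 ^ w"
      using length_history_mono[of "Suc k" j us j] k w by simp
    have wL: "node_length (Suc k) < 2 ^ w" using node_length_mono[of "Suc k" j] k w by simp
    have "2 * Suc k \<le> 10 * 4 ^ Suc k" by (induction k) auto
    then have kw: "2 * Suc k < 2 ^ w" using pk(2) by (rule le_less_trans)
    have lev: "runs w emit_level (r', store m (?H k)) ?T Q'"
      if Q': "\<And>r''. \<lbrakk>r'' 5 = length (?H (Suc k)); r'' 6 = length (?H k);
        \<And>y. y \<notin> {5, 6, 7, 12, 13, 14} \<Longrightarrow> r'' y = r' y\<rbrakk> \<Longrightarrow>
        Q' (r'', store m (?H (Suc k)))" for Q'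
    proof -
      have "runs w emit_level (r', store m (?H k))
          (length (?U (Suc k)) * (5 * node_length (Suc k) + 16) + 2) Q'"
        by (rule runs_emit_level[OF split, where b = b, unfolded next_H])
           (use I r xs(2) bk' bseg wH in
             \<open>auto simp: I_def simp del: history.simps node_length.simps intro: Q'\<close>)
      moreover have "length (?U (Suc k)) * (5 * node_length (Suc k) + 16) \<le>
          4 ^ j * length us * (5 * node_length j + 16)"
        using node_length_mono[of "Suc k" j] k
        by (intro mult_le_mono) (auto intro: power_increasing)
      ultimately show ?thesis by (rule runs_time[OF _ add_right_mono])
    qed
    have "r' 11 < r' 1" using I k r by (simp add: I_def)
    moreover have "runs w (block [emit_level, next_level]) (r', m') (?T + 10) (\<lambda>(r', m'). I (Suc k) r' m')"
      unfolding m' block.simps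
    proof (intro runs_Seq lev runs_next_level, goal_cases)
      case (5 r1 r2)
      have "\<exists>xs. ?H (Suc k) = xs @ arr (Suc k) (?U (Suc k)) \<and> length (?H k) = length xs"
        by (metis next_H)
      with 5 I show ?case by (simp add: I_def del: history.simps)
    qed (use I r wL pk kw in \<open>auto simp: I_def\<close>)
    ultimately show ?case by blast
  next
    case (2 r' m')
    then show ?case using Q r by (auto simp: I_def)
  next
    case 3
    show ?case using r by (auto simp: I_def entries_def)
  qed
  then show ?thesis by (rule runs_time) (simp add: distrib_left)
qed

section \<open>Writing the final expression\<close>

definition emit_star :: prog where
  "emit_star = block [emit_const 0, copy_pad, emit_const 2, emit_const 4]"

lemma runs_emit_star:
  assumes r: "r 5 = length ms" "r 4 = 1" "r 10 = d" "r 16 = 0"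
    and "r 8 + d \<le> length ms" "seg ms (r 8) d = xs" "length ms + d + 5 < 2 ^ w"
    and Q: "\<And>r'. \<lbrakk>r' 5 = length ms + d + 3; \<And>y. y \<notin> {5, 12, 13, 14} \<Longrightarrow> r' y = r y\<rbrakk> \<Longrightarrow>
      Q (r', store m (ms @ [0] @ xs @ [2, 4]))"
  shows "runs w emit_star (r, store m ms) (5 * d + 12) Q"
proof -
  have "length xs = d" using assms(5,6) by auto
  then have "runs w emit_star (r, store m ms) (3 + ((5 * d + 3) + (3 + 3))) Q"
    unfolding emit_star_def block.simps
    apply (intro runs_Seq runs_emit_const runs_copy_pad)
    using assms(1-7) apply (simp_all add: seg_append)
    using Q by simp
  then show ?thesis by (rule runs_time) simp
qed

definition emit_opens :: prog where
  "emit_opens = block [Const 11 0, WhileLess 11 0 (block [emit_const 0, Add 11 11 4])]"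

lemma runs_emit_opens:
  assumes r: "r 5 = length ms" "r 4 = 1" "r 0 = N" and w: "length ms + N < 2 ^ w"
    and Q: "\<And>r'. \<lbrakk>r' 5 = length ms + N; \<And>y. y \<notin> {5, 11, 12} \<Longrightarrow> r' y = r y\<rbrakk> \<Longrightarrow>
      Q (r', store m (ms @ replicate N 0))"
  shows "runs w emit_opens (r, store m ms) (5 * N + 2) Q"
proof -
  define I where "I i r' m' \<longleftrightarrow> r' 5 = length ms + i \<and> r' 11 = i \<and>
    (\<forall>y. y \<notin> {5, 11, 12} \<longrightarrow> r' y = r y) \<and> m' = store m (ms @ replicate i 0)"
    for i and r' m' :: "nat \<Rightarrow> nat"
  have "runs w emit_opens (r, store m ms) (1 + (N * ((3 + 1) + 1) + 1)) Q"
    unfolding emit_opens_def block.simps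
  proof (intro runs_Seq runs_Const runs_While[where I = I], goal_cases)
    case (2 i r' m')
    then have m': "m' = store m (ms @ replicate i 0)" by (simp add: I_def)
    show ?case unfolding m'
      apply (intro conjI runs_Seq runs_emit_const runs_Add)
      using 2 r w by (auto simp: I_def replicate_append_same)
  qed (use Q r in \<open>auto simp: I_def\<close>)
  then show ?thesis by (rule runs_time) simp
qed

definition emit_choices :: prog where
  "emit_choices = block [Const 11 0,
     WhileLess 11 0 (block [emit_const 1, copy_block, emit_const 2, Add 11 11 4])]"

text \<open>The array holds blocks for more tensors than are wanted, and only the first
  \<open>N\<close> are copied. The suffix \<open>ys\<close> stands for what was appended after the
  array.\<close>

lemma runs_emit_choices:
  fixes us k defines "l \<equiv> node_length k"
    and "ts \<equiv> \<lambda>us. concat (map (\<lambda>u. 1 # tokens (tensor_regex k u) @ [2]) us)"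
  assumes ms: "\<exists>ys. ms = xs @ arr k us @ ys"
    and r: "r 5 = length ms" "r 4 = 1" "r 0 = N" "r 6 = length xs" "r 9 = l"
    and N: "N \<le> length us" and w: "length ms + N * (l + 2) + 3 < 2 ^ w"
    and Q: "\<And>r'. \<lbrakk>r' 5 = length ms + N * (l + 2);
        \<And>y. y \<notin> {5, 6, 11, 12, 13} \<Longrightarrow> r' y = r y\<rbrakk> \<Longrightarrow> Q (r', store m (ms @ ts (take N us)))"
  shows "runs w emit_choices (r, store m ms) (N * (5 * l + 10) + 2) Q"
proof -
  obtain ys where ys: "ms = xs @ arr k us @ ys" using ms by blast
  define I where "I i r' m' \<longleftrightarrow> r' 5 = length ms + i * (l + 2) \<and> r' 6 = length xs + i * l \<and> r' 11 = i \<and>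
    (\<forall>y. y \<notin> {5, 6, 11, 12, 13} \<longrightarrow> r' y = r y) \<and> m' = store m (ms @ ts (take i us))"
    for i and r' m' :: "nat \<Rightarrow> nat"
  have ts: "length (ts vs) = length vs * (l + 2)" for vs
    by (induction vs) (simp_all add: ts_def l_def)
  have "runs w emit_choices (r, store m ms) (1 + (N * ((3 + ((5 * l + 2) + (3 + 1))) + 1) + 1)) Q"
    unfolding emit_choices_def block.simps
  proof (intro runs_Seq runs_Const runs_While[where I = I], goal_cases)
    case (2 i r' m')
    then have m': "m' = store m (ms @ ts (take i us))" and i: "i < length us" "i < N"
      using N by (simp_all add: I_def)
    have "Suc i * l \<le> length us * l" using i by (intro mult_right_mono) auto
    then have le: "length xs + i * l + l \<le> length ms" by (simp add: ys l_def)
    have "Suc i * (l + 2) \<le> N * (l + 2)" using i by (intro mult_right_mono) auto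
    then have wi: "length ms + i * (l + 2) + l + 5 < 2 ^ w" using w by simp
    have "seg (arr k us @ ys) (i * l) l = tokens (tensor_regex k (us ! i))"
    proof -
      have "Suc i * l \<le> length us * l" using i by (intro mult_right_mono) auto
      then have "seg (arr k us @ ys) (i * l) l = seg (arr k us) (i * l) l"
        by (intro seg_append) (simp add: l_def)
      also have "\<dots> = tokens (tensor_regex k (us ! i))"
        unfolding arr_def by (subst seg_concat_uniform) (use i in \<open>auto simp: l_def\<close>)
      finally show ?thesis .
    qed
    then have sg: "seg (ms @ zs) (length xs + i * l) l = tokens (tensor_regex k (us ! i))" for zs
      using seg_append[OF le] by (simp add: ys seg_append_right)
    have nx: "ts (take (Suc i) us) = ts (take i us) @ [1] @ tokens (tensor_regex k (us ! i)) @ [2]"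
      using i by (simp add: take_Suc_conv_app_nth) (simp add: ts_def)
    have lt: "length (tokens (tensor_regex k (us ! i))) = l" by (simp add: l_def)
    show ?case unfolding m'
      apply (intro conjI runs_Seq runs_emit_const runs_copy_block runs_Add)
      using 2 r i le wi by (auto simp: I_def ts sg[unfolded l_def] nx lt l_def min_absorb2)
  qed (use Q r w in \<open>auto simp: I_def ts_def\<close>)
  then show ?thesis by (rule runs_time) simp
qed

text \<open>Register 10 becomes \<open>5 * D\<close>, the written length of a padding of length
  \<open>D\<close>, and 7 is the code of the symbol 2. The value \<open>N * D\<close> is both the
  length of the string and its address, because the second set follows the \<open>N\<close> tensors
  of the first.\<close>

definition emit_output :: prog where
  "emit_output = block [Add 15 5 16, Add 10 2 2, Add 10 10 10, Add 10 10 2, emit_star, emit_opens,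
     emit_const 7, emit_choices, emit_star, Sub 1 5 15, Add 0 15 16, Add 2 3 16]"

lemma tokens_OAPT_regex:
  "tokens (OAPT_regex k us) =
     ([0] @ pad_tokens (4 ^ k) @ [2, 4]) @ replicate (length us) 0 @ [7] @
     concat (map (\<lambda>u. 1 # tokens (tensor_regex k u) @ [2]) us) @ [0] @ pad_tokens (4 ^ k) @ [2, 4]"
  by (simp add: OAPT_regex_def tokens_pad_minus_1 tokens_choice comp_def)

lemma length_tokens_OAPT_regex:
  "length (tokens (OAPT_regex k us)) =
     10 * 4 ^ k + 7 + length us + length us * (node_length k + 2)"
proof -
  have "length (concat (map (\<lambda>u. 1 # tokens (tensor_regex k u) @ [2]) us)) =
      length us * (node_length k + 2)"
    by (induction us) simp_all
  then show ?thesis by (simp add: tokens_OAPT_regex)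
qed

lemma runs_emit_output:
  assumes ms: "ms = xs @ arr k us"
    and r: "r 5 = length ms" "r 4 = 1" "r 0 = N" "r 2 = 4 ^ k" "r 3 = M" "r 6 = length xs"
      "r 9 = node_length k" "r 16 = 0"
    and N: "N \<le> length us"
    and pad: "r 8 + 5 * 4 ^ k \<le> length ms" "seg ms (r 8) (5 * 4 ^ k) = pad_tokens (4 ^ k)"
    and w: "length (ms @ tokens (OAPT_regex k (take N us))) + 5 < 2 ^ w" "M < 2 ^ w"
    and Q: "\<And>r'. \<lbrakk>r' 0 = length ms; r' 1 = length (tokens (OAPT_regex k (take N us)));
        r' 2 = M; r' 3 = M\<rbrakk> \<Longrightarrow> Q (r', store m (ms @ tokens (OAPT_regex k (take N us))))"
  shows "runs w emit_output (r, store m ms)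
    (50 * 4 ^ k + 5 * N + N * (5 * node_length k + 10) + 50) Q"
proof -
  let ?d = "5 * 4 ^ k :: nat" and ?P = "pad_tokens (4 ^ k)"
  let ?C = "concat (map (\<lambda>u. 1 # tokens (tensor_regex k u) @ [2]) (take N us))"
  have lC: "length ?C = N * (node_length k + 2)"
  proof -
    have "length (concat (map (\<lambda>u. 1 # tokens (tensor_regex k u) @ [2]) vs)) =
        length vs * (node_length k + 2)" for vs by (induction vs) simp_all
    then show ?thesis using N by simp
  qed
  have R: "tokens (OAPT_regex k (take N us)) =
      ([0] @ ?P @ [2, 4]) @ replicate N 0 @ [7] @ ?C @ [0] @ ?P @ [2, 4]"
    using N by (simp add: tokens_OAPT_regex min_absorb2)
  have w': "length ms + 10 * 4 ^ k + 7 + N + N * (node_length k + 2) + 5 < 2 ^ w"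
    using w N by (simp add: length_tokens_OAPT_regex min_absorb2)
  have sg: "seg (ms @ zs) (r 8) ?d = ?P" for zs using pad by (simp add: seg_append)
  have Q': "\<lbrakk>r' 0 = length ms; r' 1 = length (tokens (OAPT_regex k (take N us))); r' 2 = M; r' 3 = M;
      ms' = ms @ tokens (OAPT_regex k (take N us))\<rbrakk> \<Longrightarrow> Q (r', store m ms')" for r' ms'
    using Q by simp
  have "runs w emit_output (r, store m ms)
    (1 + (1 + (1 + (1 + ((5 * ?d + 12) + ((5 * N + 2) + (3 + ((N * (5 * node_length k + 10) + 2) +
       ((5 * ?d + 12) + (1 + (1 + 1))))))))))) Q"
    unfolding emit_output_def block.simps
    by (intro runs_Seq runs_Add runs_Sub runs_emit_const runs_emit_star[where xs = ?P]
        runs_emit_opens runs_emit_choices[where us = us and k = k and xs = xs] Q')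
      (use r N pad w' w(2) in \<open>simp_all add: sg[unfolded ms append_assoc] lC[unfolded One_nat_def] R ms\<close>)
  then show ?thesis by (rule runs_time) simp
qed

section \<open>Initialization and correctness of the whole program\<close>

text \<open>\<open>D\<close> is obtained by \<open>t\<close> doublings and \<open>N * D\<close> by
  \<open>N\<close> additions. Register 5 skips the input and \<open>D\<close> zero words behind it.
  The leaves of the \<open>2 * N\<close> input tensors take \<open>10 * (N * D)\<close> words from
  there on, which gives the address of the padding in register 8.\<close>

definition setup_registers :: prog where
  "setup_registers = block [Const 4 1, Const 2 1, WhileLess 11 1 (block [Add 2 2 2, Add 11 11 4]),
     Const 11 0, WhileLess 11 0 (block [Add 3 3 2, Add 11 11 4]),
     Add 12 3 3, Add 5 12 2, Add 7 5 16, Add 8 5 12, Add 8 8 12, Add 8 8 12, Add 8 8 12, Add 8 8 12,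
     Const 9 5, Const 10 10, Const 11 0]"

lemma runs_setup_registers:
  fixes N t defines "D \<equiv> 2 ^ t"
  assumes w: "12 * (N * D) + D < 2 ^ w" "t < 2 ^ w" "N < 2 ^ w" "10 < (2::nat) ^ w"
    and Q: "\<And>r'. \<lbrakk>r' 0 = N; r' 1 = t; r' 2 = D; r' 3 = N * D; r' 4 = 1; r' 5 = 2 * (N * D) + D;
        r' 6 = 0; r' 7 = 2 * (N * D) + D; r' 8 = 12 * (N * D) + D; r' 9 = 5; r' 10 = 10; r' 11 = 0;
        r' 16 = 0\<rbrakk> \<Longrightarrow> Q (r', m)"
  shows "runs w setup_registers ((\<lambda>_. 0)(0 := N, 1 := t), m) (3 * t + 3 * N + 20) Q"
proof -
  have power: "runs w (WhileLess 11 1 (block [Add 2 2 2, Add 11 11 4])) (r, m) (t * ((1 + 1) + 1) + 1) Q'"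
    if r: "r 11 = 0" "r 1 = t" "r 2 = 1" "r 4 = 1"
      and Q': "\<And>r'. r' 2 = D \<Longrightarrow> (\<And>y. y \<notin> {2, 11} \<Longrightarrow> r' y = r y) \<Longrightarrow> Q' (r', m)" for r Q'
  proof (rule runs_While[where I = "\<lambda>i r' m'. m' = m \<and> r' 2 = 2 ^ i \<and> r' 11 = i \<and>
      (\<forall>y. y \<notin> {2, 11} \<longrightarrow> r' y = r y)"], goal_cases)
    case (1 i r' m')
    then have "(2::nat) ^ Suc i \<le> D" unfolding D_def by (intro power_increasing) auto
    then have "2 * 2 ^ i < (2::nat) ^ w" using w by simp
    with 1 show ?case unfolding block.simps
      by (intro conjI runs_Seq runs_Add) (use r w in auto)
  qed (use r Q' in \<open>auto simp: D_def\<close>)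
  have mult: "runs w (WhileLess 11 0 (block [Add 3 3 2, Add 11 11 4])) (r, m) (N * ((1 + 1) + 1) + 1) Q'"
    if r: "r 11 = 0" "r 0 = N" "r 3 = 0" "r 2 = D" "r 4 = 1"
      and Q': "\<And>r'. r' 3 = N * D \<Longrightarrow> (\<And>y. y \<notin> {3, 11} \<Longrightarrow> r' y = r y) \<Longrightarrow> Q' (r', m)" for r Q'
  proof (rule runs_While[where I = "\<lambda>i r' m'. m' = m \<and> r' 3 = i * D \<and> r' 11 = i \<and>
      (\<forall>y. y \<notin> {3, 11} \<longrightarrow> r' y = r y)"], goal_cases)
    case (1 i r' m')
    then have "Suc i * D \<le> N * D" by (intro mult_right_mono) auto
    then have "i * D + D < 2 ^ w" using w by simp
    with 1 show ?case unfolding block.simps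
      by (intro conjI runs_Seq runs_Add) (use r w in auto)
  qed (use r Q' in auto)
  have "runs w setup_registers ((\<lambda>_. 0)(0 := N, 1 := t), m) (1 + (1 + ((t * ((1 + 1) + 1) + 1) + (1 +
      ((N * ((1 + 1) + 1) + 1) + (1 + (1 + (1 + (1 + (1 + (1 + (1 + (1 + (1 + (1 + 1))))))))))))))) Q"
    \<comment> \<open>The restricted equations flatten only the outer block; the loop bodies stay
      folded, as in \<open>power\<close> and \<open>mult\<close>.\<close>
    unfolding setup_registers_def block.simps(1,2)[of "Const _ _"] block.simps(1,2)[of "WhileLess _ _ _"]
      block.simps(2)[of "Add _ _ _" "Add _ _ _" "_ # _"] block.simps(2)[of _ "Const _ _"]
    apply (intro runs_Seq runs_Const power mult runs_Add)
    using w apply simp_all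
    using Q by simp
  then show ?thesis by (rule runs_time) simp
qed

definition reduction :: prog where
  "reduction = block [setup_registers, emit_leaves, emit_levels, emit_output]"

lemma funpow_split4_False: "(split4 ^^ j) [\<lambda>_. False] = replicate (4 ^ j) (\<lambda>_. False)"
proof -
  have "split4 (replicate n (\<lambda>_. False)) = replicate (4 * n) (\<lambda>_. False)" for n
    by (induction n) (simp_all add: split4_def numeral_eq_Suc)
  then show ?thesis by (induction j) simp_all
qed

lemma arr_0_False: "arr 0 (replicate n (\<lambda>_. False)) = pad_tokens n"
  by (induction n) (simp_all add: arr_def pad_tokens_def tokens_leaf)

lemma stored_at_store:
  "p + length ws \<le> length ms \<Longrightarrow> length ms \<le> 2 ^ w \<Longrightarrow> seg ms p (length ws) = ws \<Longrightarrow>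
     stored_at w (store m ms) p ws"
  unfolding stored_at_def store_def seg_def
  by (auto simp: nth_append) (metis add_leD1 nth_drop nth_take)

text \<open>
  The appended all-false tensor is the zero memory behind the input; its leaves are the
  written form of a padding of length \<open>D\<close>.
\<close>

lemma runs_reduction:
  fixes j N as bs defines "D \<equiv> 4 ^ j" and "t \<equiv> 2 * j"
  defines "us \<equiv> as @ bs @ [\<lambda>_. False]"
  defines "R \<equiv> OAPT_regex j as" and "S \<equiv> concat (map (tensor_words t) bs)"
  defines "L \<equiv> node_length j" and "M \<equiv> 4 ^ j * length us"
  assumes len: "length as = N" "length bs = N"
    and w: "length (history us j j) + length (tokens R) + 12 * (N * D) + 20 * D + L + N + 20 < 2 ^ w"
  shows "runs w reduction (OAPT_input t N as bs)
    ((3 * t + 3 * N + 20) + ((M * 19 + 1) + ((j * (M * (5 * L + 16) + 13) + 1) +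
      (50 * D + 5 * N + N * (5 * L + 10) + 50)))) (\<lambda>s. membership_output w s R S)"
proof -
  let ?H = "history us j"
  have D: "2 ^ t = D" by (simp add: D_def t_def power_mult)
  have lus: "length us = 2 * N + 1" by (simp add: us_def len)
  have M: "M = 2 * (N * D) + D" by (simp add: M_def lus D_def algebra_simps)
  have E: "entries ((split4 ^^ j) us) =
      concat (map (tensor_words t) as) @ S @ replicate D 0"
    unfolding us_def funpow_split4_append
    by (simp add: entries_def S_def t_def D_def funpow_split4_False
        flip: entries_split4[unfolded entries_def])
  have lw: "length (concat (map (tensor_words t) vs)) = length vs * D" for vs
    by (induction vs) (simp_all add: length_tensor_words D)
  \<comment> \<open>The all-false tensor is last in \<open>us\<close>, so its leaves end the memory
    of level 0 and form the padding there.\<close>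
  have H0: "?H 0 = (entries ((split4 ^^ j) us) @ arr 0 ((split4 ^^ j) (as @ bs))) @ pad_tokens D"
    unfolding history.simps by (subst (2) us_def)
      (simp add: funpow_split4_append arr_0_False funpow_split4_False D_def flip: append_assoc)
  have lH0: "length (entries ((split4 ^^ j) us) @ arr 0 ((split4 ^^ j) (as @ bs))) = 12 * (N * D) + D"
    by (simp add: entries_def lus len D_def algebra_simps)
  have pads: "12 * (N * D) + D + 5 * D \<le> length (?H 0)"
      "seg (?H 0) (12 * (N * D) + D) (5 * D) = pad_tokens D"
    unfolding H0 using lH0 by (simp_all add: seg_def)
  obtain ys where ys: "?H j = ?H 0 @ ys" using history_prefix by blast
  have padsj: "12 * (N * D) + D + 5 * D \<le> length (?H j)"
      "seg (?H j) (12 * (N * D) + D) (5 * D) = pad_tokens D"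
    using pads seg_append[OF pads(1)] by (simp_all only: ys) simp
  \<comment> \<open>The background is zero, so counting \<open>D\<close> further zero words as
    written does not change the memory.\<close>
  have input: "OAPT_input t N as bs =
      ((\<lambda>_. 0)(0 := N, 1 := t), store (\<lambda>_. 0) (entries ((split4 ^^ j) us)))"
    unfolding OAPT_input_def E
    by (auto simp: Let_def store_def S_def fun_eq_iff nth_append)
  have "t < D" unfolding D[symmetric] by (rule less_exp)
  have takeN: "take N us = as" by (simp add: us_def len)
  \<comment> \<open>The string is never copied; it is the second part of the input, left in
    place.\<close>
  have Sseg: "seg (?H j @ zs) (N * D) (length S) = S" for zs
  proof -
    have "?H j @ zs = concat (map (tensor_words t) as) @ S @
        (replicate D 0 @ arr 0 ((split4 ^^ j) us) @ ys @ zs)"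
      unfolding ys history.simps E by simp
    then show ?thesis using lw[of as] len by (simp add: seg_def)
  qed
  have lS: "length S = N * D" using lw[of bs] len by (simp add: S_def)
  have out: "membership_output w (r, store m (?H j @ tokens R)) R S"
    if "r 0 = length (?H j)" "r 1 = length (tokens R)" "r 2 = N * D" "r 3 = N * D" for r m
  proof -
    have "stored_at w (store m (?H j @ tokens R)) (length (?H j)) (tokens R)"
      by (rule stored_at_store) (use w in \<open>simp_all add: seg_def\<close>)
    moreover have "stored_at w (store m (?H j @ tokens R)) (N * D) S"
      by (rule stored_at_store) (use w padsj Sseg lS in simp_all)
    ultimately show ?thesis
      using that lS by (simp add: membership_output_def regex_length_def tokens_def)
  qed
  show ?thesis
    unfolding reduction_def block.simps input
  proof (intro runs_Seq runs_setup_registers, goal_cases)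
    case (5 r1)
    note r1 = 5[unfolded D]
    have M': "M = length ((split4 ^^ j) us)" by (simp add: M_def)
    show ?case unfolding M'
    proof (rule runs_emit_leaves, goal_cases)
      case (6 r2)
      have H: "entries ((split4 ^^ j) us) @ arr 0 ((split4 ^^ j) us) = ?H 0" by simp
      show ?case unfolding H M'[symmetric] unfolding M_def L_def
      proof (intro runs_Seq runs_emit_levels[where b = "12 * (N * D) + D"], goal_cases)
        case (15 r3 xs)
        note r3 = this
        show ?case unfolding L_def[symmetric] unfolding D_def L_def
        proof (rule runs_emit_output[where xs = xs and us = us and N = N and M = "N * D", unfolded takeN], goal_cases)
          case (15 r4)
          then show ?case unfolding R_def[symmetric] by (intro out)
        qed (use r3 6 r1 w padsj in \<open>auto simp: R_def[symmetric] D_def lus\<close>)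
      qed (use 6 r1 w pads length_history_mono[of 0 j us j] in
          \<open>auto simp: H t_def L_def D_def M M_def[symmetric] simp del: history.simps\<close>)
    qed (use r1 w M M' in auto)
  qed (use w \<open>t < D\<close> D in auto)
qed

section \<open>Polynomial bounds on size and time\<close>

theorem theorem7p6:
  shows "\<exists>(P :: prog) (C :: nat) (c :: nat).
    \<forall>(t :: nat) (N :: nat) (A :: (bool list \<Rightarrow> bool) set) (B :: (bool list \<Rightarrow> bool) set) as bs.
      restricted_OAPT_instance t N A B \<and> enumerates as A \<and> enumerates bs B \<longrightarrow>
      (let D = 2 ^ t; bound = C * N * D ^ c in
        \<exists>(R :: nat regex) (S :: nat list).
          regex_length R \<le> bound \<and> length S \<le> bound \<and>
          (S \<in> lang R \<longleftrightarrow> OAPT t A B) \<and>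
          (\<forall>w. bound \<le> 2 ^ w \<longrightarrow>
            (\<exists>T s. exec w P (OAPT_input t N as bs) T s \<and> T \<le> bound \<and>
              membership_output w s R S)))"
proof (rule exI[of _ reduction], rule exI[of _ 1000], rule exI[of _ 4], intro allI impI, elim conjE)
  fix t N A B as bs
  assume inst: "restricted_OAPT_instance t N A B" and as: "enumerates as A" and bs: "enumerates bs B"
  from inst have "even t" and N: "1 \<le> N" and card: "card A = N" "card B = N"
    by (auto simp: restricted_OAPT_instance_def)
  from \<open>even t\<close> obtain j where t: "t = 2 * j" by (elim evenE)
  have len: "length as = N" "length bs = N" and set: "set as = A" "set bs = B"
    using as bs card by (auto simp: enumerates_def distinct_card)
  define D :: nat where "D = 4 ^ j"
  \<comment> \<open>The exponent comes from the levels: at most \<open>D\<close> of them, with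
    \<open>O(N * D)\<close> blocks of length \<open>O(D\<^sup>2)\<close> each. The factor 1000
    leaves room for all constants.\<close>
  define X where "X = N * D ^ 4"
  define us where "us = as @ bs @ [\<lambda>_. False]"
  define M where "M = 4 ^ j * length us"
  define L where "L = node_length j"
  let ?R = "OAPT_regex j as" and ?S = "concat (map (tensor_words t) bs)"
  have D1: "1 \<le> D" by (simp add: D_def)
  have pow: "N * D ^ i \<le> X" if "i \<le> 4" for i
    unfolding X_def using D1 that by (intro mult_le_mono2 power_increasing)
  have NX: "N \<le> X" "N * D \<le> X" using pow[of 0] pow[of 1] by simp_all
  have DX: "D \<le> X" using NX(2) N by (metis le_trans mult_le_mono1 nat_mult_1)
  have jD: "Suc j \<le> D" unfolding D_def by (induction j) auto
  have M3: "M \<le> 3 * (N * D)"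
  proof -
    have "M = 2 * (N * D) + D" by (simp add: M_def us_def len D_def algebra_simps)
    moreover have "D \<le> N * D" using N by simp
    ultimately show ?thesis by simp
  qed
  have L5: "L \<le> 5 * D\<^sup>2"
    using node_length_le[of j] by (simp add: L_def D_def power2_eq_square flip: power_mult_distrib)
  have NL: "N * L \<le> 5 * X"
  proof -
    have "N * L \<le> N * (5 * D\<^sup>2)" using L5 by (rule mult_le_mono2)
    also have "\<dots> \<le> 5 * X" using pow[of 2] by simp
    finally show ?thesis .
  qed
  have JML: "Suc j * (M * L) \<le> 15 * X"
  proof -
    have "Suc j * (M * L) \<le> D * (3 * (N * D) * (5 * D\<^sup>2))"
      using jD M3 L5 by (intro mult_le_mono)
    also have "\<dots> = 15 * X" by (simp add: X_def power2_eq_square power4_eq_xxxx algebra_simps)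
    finally show ?thesis .
  qed
  have JM: "j * M \<le> 3 * X"
  proof -
    have "j * M \<le> D * (3 * (N * D))" using jD M3 by (intro mult_le_mono) auto
    also have "\<dots> = 3 * (N * D\<^sup>2)" by (simp add: power2_eq_square algebra_simps)
    also have "\<dots> \<le> 3 * X" using pow[of 2] by simp
    finally show ?thesis .
  qed
  have X1: "1 \<le> X" using NX(1) N by simp
  have LX: "L \<le> 5 * X" using NL N by (metis le_trans mult_le_mono1 nat_mult_1)
  have H: "length (history us j j) \<le> M + Suc j * (M * L)"
    using length_history_le[of j j us] by (simp add: M_def L_def)
  have R: "length (tokens ?R) = 10 * D + 7 + N + (N * L + 2 * N)"
    by (simp add: length_tokens_OAPT_regex len D_def L_def)
  have bound: "1000 * N * (2 ^ t) ^ 4 = 1000 * X" by (simp add: X_def D_def t power_mult)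
  have MX: "M \<le> 3 * X" using M3 NX by simp
  have len_R: "regex_length ?R \<le> 1000 * X"
    using R NX DX NL X1 by (simp add: regex_length_def tokens_def)
  have len_S: "length ?S \<le> 1000 * X"
  proof -
    have "length (concat (map (tensor_words t) vs)) = length vs * D" for vs
      by (induction vs) (simp_all add: length_tensor_words t D_def power_mult)
    then show ?thesis using NX len by simp
  qed
  have run: "\<exists>T s. exec w reduction (OAPT_input t N as bs) T s \<and> T \<le> 1000 * X \<and>
      membership_output w s ?R ?S" if w: "1000 * X \<le> 2 ^ w" for w
  proof -
    \<comment> \<open>Everything written, with some slack, stays below \<open>1000 * X\<close>, so
      all addresses and counters fit into a word.\<close>
    have fits: "length (history us j j) + length (tokens ?R) + 12 * (N * 4 ^ j) + 20 * 4 ^ j +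
        node_length j + N + 20 < 2 ^ w"
      using w H R NX DX NL JML X1 LX MX unfolding L_def[symmetric] D_def[symmetric] by linarith
    have time: "(3 * t + 3 * N + 20) + ((M * 19 + 1) + ((j * (M * (5 * L + 16) + 13) + 1) +
      (50 * D + 5 * N + N * (5 * L + 10) + 50))) \<le> 1000 * X" (is "?T \<le> _")
    proof -
      have "?T = 6 * j + 8 * N + 19 * M + 5 * (j * (M * L)) + 16 * (j * M) + 13 * j + 50 * D +
          5 * (N * L) + 10 * N + 72"
        by (simp add: t algebra_simps)
      moreover have "j * (M * L) \<le> 15 * X" using JML by simp
      moreover have "j \<le> X" using jD DX by simp
      ultimately show ?thesis using NX DX NL JM X1 MX by linarith
    qed
    have "runs w reduction (OAPT_input t N as bs) ?T (\<lambda>s. membership_output w s ?R ?S)"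
      using runs_reduction[OF len fits[unfolded us_def]]
      unfolding t M_def us_def L_def D_def .
    with time show ?thesis unfolding runs_def by (meson le_trans)
  qed
  show "let D = 2 ^ t; bound = 1000 * N * D ^ 4 in
        \<exists>(R :: nat regex) (S :: nat list).
          regex_length R \<le> bound \<and> length S \<le> bound \<and>
          (S \<in> lang R \<longleftrightarrow> OAPT t A B) \<and>
          (\<forall>w. bound \<le> 2 ^ w \<longrightarrow>
            (\<exists>T s. exec w reduction (OAPT_input t N as bs) T s \<and> T \<le> bound \<and>
              membership_output w s R S))"
    unfolding Let_def bound
    using len_R len_S run in_lang_OAPT_regex_iff[of j bs as] t set by blast
qed

end
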